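(* Let $A=\begin{pmatrix} a & b\\ c & d\end{pmatrix}\in SL(2,\mathbb{Z})$ be fixed (an element of the mapping class group of the closed torus $T^2$), and let $[\gamma]\in\mathcal{X}_{SL(2,\mathbb{C})}(T^2)$ be a fixed $A$-invariant character, represented by $\gamma$ with $\gamma(\alpha)=\begin{pmatrix}\lambda_1&0\\0&\lambda_1^{-1}\end{pmatrix}$ and $\gamma(\beta)=\begin{pmatrix}\lambda_2&0\\0&\lambda_2^{-1}\end{pmatrix}$. (So $1=\lambda_1^{a-1}\lambda_2^{b}$ and $1=\lambda_1^{c}\lambda_2^{d-1}$, or $1=\lambda_1^{a+1}\lambda_2^{b}$ and $1=\lambda_1^{c}\lambda_2^{d+1}$.) If $1=\lambda_1^{a-1}\lambda_2^{b}$ and $1=\lambda_1^{c}\lambda_2^{d-1}$, let $\{\Lambda_n\}_{n\ge 1,\ n \text{ odd}}$ be a sequence of $(+)$-intertwiners for $(A,\lambda_1,\lambda_2)$ at level $n$; if $1=\lambda_1^{a+1}\lambda_2^{b}$ and $1=\lambda_1^{c}\lambda_2^{d+1}$, let $\{\Lambda_n\}_{n\ge 1,\ n\text{ odd}}$ be a sequence of $(-)$-intertwiners for $(A,\lambda_1,\lambda_2)$ at level $n$; in each case normalized so that $|\det(\Lambda_n)|=1$ for all odd $n$. Then $$\limsup_{\text{odd } n\to\infty}\frac{\log(|\mathrm{Trace}\,\Lambda_n|)}{n}=0 .$$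
   Context: $\pi_1(T^2)=\mathbb{Z}\alpha\oplus\mathbb{Z}\beta$ with $\alpha=(1,0)$, $\beta=(0,1)$ in $T^2=\mathbb{R}^2/\mathbb{Z}^2$. $\mathcal{X}_{SL(2,\mathbb{C})}(T^2)$ is the set of homomorphisms $\pi_1(T^2)\to SL(2,\mathbb{C})$ modulo the relation of having the same character (trace function); every class has a diagonal representative. $A$ acts on $\pi_1(T^2)$ by $A_*(k_1\alpha+k_2\beta)=(k_1,k_2)A$ (row vector times matrix), and $[\gamma]$ is $A$-invariant if $[\gamma\circ A_*]=[\gamma]$. For each odd $n\ge1$ put $q=e^{2\pi i/n}$, $q^{1/2}=e^{\pi i/n}$, and $q^{x/2}=(q^{1/2})^x$ for $x\in\mathbb{Z}$. $\mathbb{C}[X^{\pm1},Y^{\pm1}]_{q^{1/2}}$ is the algebra generated by $X^{\pm1},Y^{\pm1}$ with $XY=qYX$ (and $XX^{-1}=X^{-1}X=YY^{-1}=Y^{-1}Y=1$). For integers $k,l$ set $\theta_{(k,l)}=q^{-kl/2}X^kY^l$. The algebra automorphisms $F_{A,+}$ and $F_{A,-}$ of $\mathbb{C}[X^{\pm1},Y^{\pm1}]_{q^{1/2}}$ are given by $F_{A,+}(\theta_{(k,l)})=\theta_{(k,l)A}$ and $F_{A,-}(\theta_{(k,l)})=\theta_{(-k,-l)A}$. Let $V$ be an $n$-dimensional complex vector space with basis $e_0,\dots,e_{n-1}$ (indices modulo $n$); for nonzero $u,v\in\mathbb{C}$, $\rho_{u,v}:\mathbb{C}[X^{\pm1},Y^{\pm1}]_{q^{1/2}}\to\mathrm{End}(V)$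 is the irreducible representation with $\rho_{u,v}(X)e_i=uq^ie_i$, $\rho_{u,v}(Y)e_i=ve_{i+1}$. A $(+)$-intertwiner for $(A,\lambda_1,\lambda_2)$ at level $n$ (used when $\lambda_1=\lambda_1^a\lambda_2^b$, $\lambda_2=\lambda_1^c\lambda_2^d$) is an invertible $\Lambda_n\in\mathrm{End}(V)$ such that, for some $u,v\in\mathbb{C}$ with $u^n=-\lambda_1$, $v^n=-\lambda_2$, one has $\rho_{u,v}F_{A,+}(Z)=\Lambda_n\,\rho_{u,v}(Z)\,\Lambda_n^{-1}$ for all $Z\in\mathbb{C}[X^{\pm1},Y^{\pm1}]_{q^{1/2}}$. A $(-)$-intertwiner (used when $\lambda_1=\lambda_1^{-a}\lambda_2^{-b}$, $\lambda_2=\lambda_1^{-c}\lambda_2^{-d}$) is defined in the same way with $F_{A,-}$ in place of $F_{A,+}$ and $u^n=-\lambda_1^{-1}$, $v^n=-\lambda_2^{-1}$. Such intertwiners exist, and once $|\det\Lambda_n|=1$ is imposed, $|\mathrm{Trace}\,\Lambda_n|$ does not depend on the choices. Convention: $\log 0=-\infty$. *)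

theory Defs
  imports
    "HOL-Library.Poly_Mapping"
    "HOL-Library.Extended_Real"
    "HOL-Library.Liminf_Limsup"
    "HOL-Algebra.Elementary_Groups"
    "HOL-Algebra.QuotRing"
    "Jordan_Normal_Form.Determinant"
begin

section \<open>Characters of the torus group\<close>

definition mat_trace :: "'a::comm_monoid_add mat \<Rightarrow> 'a" where
  "mat_trace M = (\<Sum>i<dim_row M. M $$ (i, i))"

definition SL2 :: "'a::comm_ring_1 mat monoid" where
  "SL2 = \<lparr>carrier = {M \<in> carrier_mat 2 2. det M = 1}, monoid.mult = (*), one = 1\<^sub>m 2\<rparr>"

text \<open>The pair \<open>(k, l)\<close> stands for \<open>k\<alpha> + l\<beta>\<close>.\<close>

definition pi1_torus :: "(int \<times> int) monoid" where
  "pi1_torus = integer_group \<times>\<times> integer_group"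

text \<open>Row vector times matrix.\<close>

definition pi1_act :: "int mat \<Rightarrow> int \<times> int \<Rightarrow> int \<times> int" where
  "pi1_act A = (\<lambda>(k, l). (k * A $$ (0,0) + l * A $$ (1,0), k * A $$ (0,1) + l * A $$ (1,1)))"

text \<open>The class \<open>[\<gamma>]\<close>: all homomorphisms with the same trace function as \<open>\<gamma>\<close>.\<close>

definition character_class :: "(int \<times> int \<Rightarrow> complex mat) \<Rightarrow> (int \<times> int \<Rightarrow> complex mat) set" where
  "character_class \<gamma> = {\<gamma>' \<in> hom pi1_torus SL2. \<forall>x. mat_trace (\<gamma>' x) = mat_trace (\<gamma> x)}"

definition A_invariant :: "int mat \<Rightarrow> (int \<times> int \<Rightarrow> complex mat) \<Rightarrow> bool" where
  "A_invariant A \<gamma> \<longleftrightarrow> character_class (\<gamma> \<circ> pi1_act A) = character_class \<gamma>"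

definition diag2 :: "complex \<Rightarrow> complex mat" where
  "diag2 z = mat 2 2 (\<lambda>(i, j). if i \<noteq> j then 0 else if i = 0 then z else inverse z)"


section \<open>The quantum torus\<close>

text \<open>
  Throughout, \<open>s\<close> is the parameter \<open>q\<^bsup>1/2\<^esup>\<close>, so \<open>q = s\<^sup>2\<close>.  The monomials \<open>X\<^sup>k Y\<^sup>l\<close>
  form a linear basis of the algebra generated by \<open>X\<^sup>\<plusminus>\<^sup>1, Y\<^sup>\<plusminus>\<^sup>1\<close> subject to \<open>XY = qYX\<close>; an element
  is its finitely supported coefficient function in this basis, \<open>qt_term (k, l) c\<close> being
  \<open>c X\<^sup>k Y\<^sup>l\<close>.  Reordering \<open>Y\<^sup>l X\<^sup>k' = q\<^bsup>-lk'\<^esup> X\<^sup>k' Y\<^sup>l\<close> gives the product.  (The product \<open>*\<close>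
  that the library puts on polynomial mappings is not used.)
\<close>

type_synonym qtorus = "(int \<times> int) \<Rightarrow>\<^sub>0 complex"

abbreviation qt_term :: "int \<times> int \<Rightarrow> complex \<Rightarrow> qtorus" where "qt_term \<equiv> Poly_Mapping.single"
abbreviation qt_coeff :: "qtorus \<Rightarrow> int \<times> int \<Rightarrow> complex" where "qt_coeff \<equiv> Poly_Mapping.lookup"
abbreviation qt_supp :: "qtorus \<Rightarrow> (int \<times> int) set" where "qt_supp \<equiv> Poly_Mapping.keys"

definition qt_mult :: "complex \<Rightarrow> qtorus \<Rightarrow> qtorus \<Rightarrow> qtorus" where
  "qt_mult s P Q = (\<Sum>(k, l)\<in>qt_supp P. \<Sum>(k', l')\<in>qt_supp Q.
     qt_term (k + k', l + l') (s powi (- 2 * l * k') * qt_coeff P (k, l) * qt_coeff Q (k', l')))"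

definition quantum_torus :: "complex \<Rightarrow> qtorus ring" where
  "quantum_torus s = \<lparr>carrier = UNIV, monoid.mult = qt_mult s, one = qt_term (0, 0) 1,
     ring.zero = 0, add = (+)\<rparr>"

definition qt_scale :: "complex \<Rightarrow> qtorus \<Rightarrow> qtorus" where
  "qt_scale c = Poly_Mapping.map ((*) c)"

definition qt_X :: qtorus where "qt_X = qt_term (1, 0) 1"
definition qt_Y :: qtorus where "qt_Y = qt_term (0, 1) 1"

definition qt_theta :: "complex \<Rightarrow> int \<times> int \<Rightarrow> qtorus" where
  "qt_theta s = (\<lambda>(k, l). qt_scale (s powi (- k * l))
     (qt_X [^]\<^bsub>quantum_torus s\<^esub> k \<otimes>\<^bsub>quantum_torus s\<^esub> qt_Y [^]\<^bsub>quantum_torus s\<^esub> l))"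

text \<open>
  The linear map \<open>\<theta>\<^sub>x \<mapsto> \<theta>\<^bsub>g x\<^esub>\<close>.  Since \<open>X\<^sup>k Y\<^sup>l = s\<^bsup>kl\<^esup> \<theta>\<^bsub>(k,l)\<^esub>\<close>, the coefficient of \<open>Z\<close>
  at \<open>\<theta>\<^bsub>(k,l)\<^esub>\<close> is \<open>s\<^bsup>kl\<^esup>\<close> times its coefficient at \<open>X\<^sup>k Y\<^sup>l\<close>.
\<close>

definition theta_map :: "complex \<Rightarrow> (int \<times> int \<Rightarrow> int \<times> int) \<Rightarrow> qtorus \<Rightarrow> qtorus" where
  "theta_map s g Z = (\<Sum>(k, l)\<in>qt_supp Z.
     qt_scale (s powi (k * l) * qt_coeff Z (k, l)) (qt_theta s (g (k, l))))"

definition F_plus :: "complex \<Rightarrow> int mat \<Rightarrow> qtorus \<Rightarrow> qtorus" where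
  "F_plus s A = theta_map s (pi1_act A)"

definition F_minus :: "complex \<Rightarrow> int mat \<Rightarrow> qtorus \<Rightarrow> qtorus" where
  "F_minus s A = theta_map s (\<lambda>(k, l). pi1_act A (- k, - l))"


section \<open>Representations and intertwiners\<close>

definition q_half :: "nat \<Rightarrow> complex" where
  "q_half n = exp (of_real pi * \<i> / of_nat n)"

text \<open>
  Matrices act on column vectors and \<open>e\<^sub>i\<close> is the \<open>i\<close>-th unit vector, so column \<open>i\<close> of
  \<open>rho n u v Z\<close> is the image of \<open>e\<^sub>i\<close>.  From \<open>X e\<^sub>i = u q\<^sup>i e\<^sub>i\<close> and \<open>Y e\<^sub>i = v e\<^bsub>i+1\<^esub>\<close>,
  \<open>X\<^sup>k Y\<^sup>l e\<^sub>i = u\<^sup>k v\<^sup>l q\<^bsup>kj\<^esup> e\<^sub>j\<close> with \<open>j = (i + l) mod n\<close>.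
\<close>

definition rho :: "nat \<Rightarrow> complex \<Rightarrow> complex \<Rightarrow> qtorus \<Rightarrow> complex mat" where
  "rho n u v Z = mat n n (\<lambda>(j, i). \<Sum>(k, l)\<in>qt_supp Z. qt_coeff Z (k, l) *
     (if int j = (int i + l) mod int n
      then u powi k * v powi l * q_half n powi (2 * k * int j) else 0))"

text \<open>\<open>L'\<close> is the inverse of \<open>L\<close>.\<close>

definition intertwines ::
    "nat \<Rightarrow> (qtorus \<Rightarrow> qtorus) \<Rightarrow> complex \<Rightarrow> complex \<Rightarrow> complex mat \<Rightarrow> bool" where
  "intertwines n F u v L \<longleftrightarrow> L \<in> carrier_mat n n \<and>
     (\<exists>L' \<in> carrier_mat n n. inverts_mat L L' \<and> inverts_mat L' L \<and>
        (\<forall>Z. rho n u v (F Z) = L * rho n u v Z * L'))"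

definition plus_intertwiner ::
    "int mat \<Rightarrow> complex \<Rightarrow> complex \<Rightarrow> nat \<Rightarrow> complex mat \<Rightarrow> bool" where
  "plus_intertwiner A z1 z2 n L \<longleftrightarrow>
     (\<exists>u v. u ^ n = - z1 \<and> v ^ n = - z2 \<and> intertwines n (F_plus (q_half n) A) u v L)"

definition minus_intertwiner ::
    "int mat \<Rightarrow> complex \<Rightarrow> complex \<Rightarrow> nat \<Rightarrow> complex mat \<Rightarrow> bool" where
  "minus_intertwiner A z1 z2 n L \<longleftrightarrow>
     (\<exists>u v. u ^ n = - inverse z1 \<and> v ^ n = - inverse z2 \<and>
        intertwines n (F_minus (q_half n) A) u v L)"

definition log_ext :: "real \<Rightarrow> ereal" where
  "log_ext x = (if x = 0 then - \<infinity> else ereal (ln x))"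


section \<open>The constructions have the defining properties\<close>

lemma qt_sum_superset:
  fixes f :: "int \<times> int \<Rightarrow> complex \<Rightarrow> 'b::comm_monoid_add"
  assumes "finite S" "qt_supp P \<subseteq> S" "\<And>x. f x 0 = 0"
  shows "(\<Sum>x\<in>qt_supp P. f x (qt_coeff P x)) = (\<Sum>x\<in>S. f x (qt_coeff P x))"
  using assms by (intro sum.mono_neutral_left) (auto simp: in_keys_iff)

lemma qt_sum_add:
  fixes f :: "int \<times> int \<Rightarrow> complex \<Rightarrow> 'b::comm_monoid_add"
  assumes "\<And>x. f x 0 = 0" "\<And>x a b. f x (a + b) = f x a + f x b"
  shows "(\<Sum>x\<in>qt_supp (P + Q). f x (qt_coeff (P + Q) x)) =
    (\<Sum>x\<in>qt_supp P. f x (qt_coeff P x)) + (\<Sum>x\<in>qt_supp Q. f x (qt_coeff Q x))"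
proof -
  define S where "S = qt_supp P \<union> qt_supp Q \<union> qt_supp (P + Q)"
  have *: "(\<Sum>x\<in>qt_supp R. f x (qt_coeff R x)) = (\<Sum>x\<in>S. f x (qt_coeff R x))"
    if "R = P \<or> R = Q \<or> R = P + Q" for R
    unfolding S_def using that by (intro qt_sum_superset) (auto simp: assms)
  show ?thesis
    unfolding *[of P, simplified] *[of Q, simplified] *[OF disjI2[OF disjI2[OF refl]]]
    by (simp only: lookup_add assms sum.distrib)
qed

lemma qt_induct [case_names zero single add]:
  fixes Z :: qtorus
  assumes "R 0" "\<And>k l c. R (qt_term (k, l) c)" "\<And>P Q. R P \<Longrightarrow> R Q \<Longrightarrow> R (P + Q)"
  shows "R Z"
proof -
  have "Z = (\<Sum>x\<in>qt_supp Z. qt_term x (qt_coeff Z x))"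
    by (rule poly_mapping_eqI)
       (auto simp: lookup_sum lookup_single when_def in_keys_iff if_distrib sum.delta' cong: if_cong)
  moreover have "R (\<Sum>x\<in>S. qt_term x (qt_coeff Z x))" if "finite S" for S
    using that by induction (auto simp: assms)
  ultimately show ?thesis by (metis finite_keys)
qed

lemma qt_mult_alt: "qt_mult s P Q = (\<Sum>x\<in>qt_supp P. \<Sum>y\<in>qt_supp Q.
     qt_term (fst x + fst y, snd x + snd y)
       (s powi (- 2 * snd x * fst y) * qt_coeff P x * qt_coeff Q y))"
  by (simp add: qt_mult_def case_prod_beta)

lemma qt_mult_single:
  "qt_mult s (qt_term (k, l) c) (qt_term (k', l') c') =
    qt_term (k + k', l + l') (s powi (- 2 * l * k') * c * c')"
  by (cases "c = 0"; cases "c' = 0") (auto simp: qt_mult_def)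

lemma qt_mult_add_left: "qt_mult s (P + P') Q = qt_mult s P Q + qt_mult s P' Q"
  unfolding qt_mult_alt
  by (rule qt_sum_add[where f = "\<lambda>x c. \<Sum>y\<in>qt_supp Q. qt_term (fst x + fst y, snd x + snd y)
       (s powi (- 2 * snd x * fst y) * c * qt_coeff Q y)"])
     (auto simp: algebra_simps single_add sum.distrib)

lemma qt_mult_add_right: "qt_mult s P (Q + Q') = qt_mult s P Q + qt_mult s P Q'"
proof -
  have "(\<Sum>y\<in>qt_supp (Q + Q'). qt_term (fst x + fst y, snd x + snd y)
       (s powi (- 2 * snd x * fst y) * qt_coeff P x * qt_coeff (Q + Q') y)) =
    (\<Sum>y\<in>qt_supp Q. qt_term (fst x + fst y, snd x + snd y)
       (s powi (- 2 * snd x * fst y) * qt_coeff P x * qt_coeff Q y)) +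
    (\<Sum>y\<in>qt_supp Q'. qt_term (fst x + fst y, snd x + snd y)
       (s powi (- 2 * snd x * fst y) * qt_coeff P x * qt_coeff Q' y))" for x
    by (rule qt_sum_add[where f = "\<lambda>y c. qt_term (fst x + fst y, snd x + snd y)
       (s powi (- 2 * snd x * fst y) * qt_coeff P x * c)"])
       (auto simp: algebra_simps single_add)
  thus ?thesis unfolding qt_mult_alt by (simp add: sum.distrib)
qed

lemma qt_mult_zero [simp]: "qt_mult s 0 Q = 0" "qt_mult s P 0 = 0"
  by (simp_all add: qt_mult_def)

lemma powi_prod_eq:
  fixes s :: complex
  assumes "s \<noteq> 0" "a + b = c + d"
  shows "s powi a * s powi b = s powi c * s powi d"
  by (metis assms power_int_add)

lemma qt_mult_assoc:
  assumes "s \<noteq> 0"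
  shows "qt_mult s (qt_mult s P Q) R = qt_mult s P (qt_mult s Q R)"
proof (induction P rule: qt_induct)
  case (single k l c)
  show ?case
  proof (induction Q rule: qt_induct)
    case (single k' l' c')
    show ?case
    proof (induction R rule: qt_induct)
      case (single k'' l'' c'')
      have "s powi (- 2 * (l + l') * k'') * s powi (- 2 * l * k') =
        s powi (- 2 * l' * k'') * s powi (- 2 * l * (k' + k''))"
        using assms by (intro powi_prod_eq) (auto simp: algebra_simps)
      thus ?case by (simp add: qt_mult_single add.assoc mult_ac)
    qed (simp_all add: qt_mult_add_right)
  qed (simp_all add: qt_mult_add_right qt_mult_add_left)
qed (simp_all add: qt_mult_add_left)

lemma qt_mult_one: "qt_mult s (qt_term (0, 0) 1) P = P" "qt_mult s P (qt_term (0, 0) 1) = P"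
  by (induction P rule: qt_induct)
     (simp_all add: qt_mult_add_left qt_mult_add_right qt_mult_single)

lemma quantum_torus_simps [simp]:
  "carrier (quantum_torus s) = UNIV"
  "P \<otimes>\<^bsub>quantum_torus s\<^esub> Q = qt_mult s P Q"
  "\<one>\<^bsub>quantum_torus s\<^esub> = qt_term (0, 0) 1"
  "\<zero>\<^bsub>quantum_torus s\<^esub> = 0"
  "P \<oplus>\<^bsub>quantum_torus s\<^esub> Q = P + Q"
  by (simp_all add: quantum_torus_def)

lemma ring_quantum_torus:
  assumes "s \<noteq> 0"
  shows "ring (quantum_torus s)"
proof (rule ringI)
  show "abelian_group (quantum_torus s)"
    by (rule abelian_groupI) (auto simp: add_ac intro: exI[of _ "- x" for x] ab_left_minus)
  show "monoid (quantum_torus s)"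
    by (rule monoidI) (auto simp: qt_mult_assoc[OF assms] qt_mult_one)
qed (auto simp: qt_mult_add_left qt_mult_add_right)

lemma qt_scale_single [simp]: "qt_scale c (qt_term x d) = qt_term x (c * d)"
  by (simp add: qt_scale_def)

lemma qt_scale_lookup [simp]: "qt_coeff (qt_scale c P) x = c * qt_coeff P x"
  by (simp add: qt_scale_def map.rep_eq when_def)

lemma qt_scale_add: "qt_scale c (P + Q) = qt_scale c P + qt_scale c Q"
  by (rule poly_mapping_eqI) (simp add: lookup_add algebra_simps)

lemma qt_scale_zero [simp]: "qt_scale c 0 = 0" "qt_scale 0 P = 0"
  by (rule poly_mapping_eqI, simp)+

lemma qt_mult_scale:
  "qt_mult s (qt_scale c P) Q = qt_scale c (qt_mult s P Q)"
  "qt_mult s P (qt_scale c Q) = qt_scale c (qt_mult s P Q)"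
proof -
  show "qt_mult s (qt_scale c P) Q = qt_scale c (qt_mult s P Q)"
  proof (induction P rule: qt_induct)
    case (single k l d)
    show ?case by (induction Q rule: qt_induct)
      (simp_all add: qt_mult_single qt_mult_add_right qt_scale_add mult_ac)
  qed (simp_all add: qt_mult_add_left qt_scale_add)
  show "qt_mult s P (qt_scale c Q) = qt_scale c (qt_mult s P Q)"
  proof (induction P rule: qt_induct)
    case (single k l d)
    show ?case by (induction Q rule: qt_induct)
      (simp_all add: qt_mult_single qt_mult_add_right qt_scale_add mult_ac)
  qed (simp_all add: qt_mult_add_left qt_scale_add)
qed

lemma qt_relation: "qt_mult s qt_X qt_Y = qt_scale (s\<^sup>2) (qt_mult s qt_Y qt_X)" if "s \<noteq> 0"
  using that by (simp add: qt_X_def qt_Y_def qt_mult_single power_int_minus)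

lemma qt_inverse:
  assumes "s \<noteq> 0" "qt_mult s P Q = qt_term (0, 0) 1" "qt_mult s Q P = qt_term (0, 0) 1"
  shows "inv\<^bsub>quantum_torus s\<^esub> P = Q"
proof -
  interpret ring "quantum_torus s" by (rule ring_quantum_torus) fact
  show ?thesis using assms by (intro inv_char) auto
qed

lemma qt_X_pow: 
  assumes "s \<noteq> 0"
  shows "qt_X [^]\<^bsub>quantum_torus s\<^esub> (k::int) = qt_term (k, 0) 1"
proof -
  have n: "qt_X [^]\<^bsub>quantum_torus s\<^esub> (m::nat) = qt_term (int m, 0) 1" for m
    by (induction m) (simp_all add: qt_X_def qt_mult_single add.commute)
  have "inv\<^bsub>quantum_torus s\<^esub> (qt_term (int m, 0) 1) = qt_term (- int m, 0) 1" for m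
    by (rule qt_inverse) (simp_all add: assms qt_mult_single)
  from this[of "nat (- k)"] show ?thesis by (auto simp: int_pow_def2 n)
qed

lemma qt_Y_pow: 
  assumes "s \<noteq> 0"
  shows "qt_Y [^]\<^bsub>quantum_torus s\<^esub> (k::int) = qt_term (0, k) 1"
proof -
  have n: "qt_Y [^]\<^bsub>quantum_torus s\<^esub> (m::nat) = qt_term (0, int m) 1" for m
    by (induction m) (simp_all add: qt_Y_def qt_mult_single add.commute)
  have "inv\<^bsub>quantum_torus s\<^esub> (qt_term (0, int m) 1) = qt_term (0, - int m) 1" for m
    by (rule qt_inverse) (simp_all add: assms qt_mult_single)
  from this[of "nat (- k)"] show ?thesis by (auto simp: int_pow_def2 n)
qed

lemma qt_monomial:
  assumes "s \<noteq> 0"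
  shows "qt_term (k, l) c = qt_scale c
    (qt_X [^]\<^bsub>quantum_torus s\<^esub> k \<otimes>\<^bsub>quantum_torus s\<^esub> qt_Y [^]\<^bsub>quantum_torus s\<^esub> l)"
  by (simp add: qt_X_pow qt_Y_pow assms qt_mult_single)

lemma qt_theta_eq:
  assumes "s \<noteq> 0"
  shows "qt_theta s (k, l) = qt_term (k, l) (s powi (- k * l))"
  by (simp add: qt_theta_def qt_X_pow qt_Y_pow assms qt_mult_single)

lemma qt_theta_mult:
  assumes "s \<noteq> 0"
  shows "qt_mult s (qt_theta s (k, l)) (qt_theta s (k', l')) =
    qt_scale (s powi (k * l' - l * k')) (qt_theta s (k + k', l + l'))"
proof -
  have "s powi (- 2 * l * k') * s powi (- k * l) * s powi (- k' * l') =
    s powi (- 2 * l * k' + - k * l + - k' * l')" using assms by (simp only: power_int_add simp_thms)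
  also have "\<dots> = s powi ((k * l' - l * k') + - (k + k') * (l + l'))"
    by (rule arg_cong[where f = "\<lambda>x. s powi x"]) (simp add: algebra_simps)
  also have "\<dots> = s powi (k * l' - l * k') * s powi (- (k + k') * (l + l'))"
    using assms by (simp only: power_int_add simp_thms)
  finally show ?thesis by (simp only: qt_theta_eq[OF assms] qt_mult_single qt_scale_single)
qed

lemma theta_map_alt: "theta_map s g Z = (\<Sum>x\<in>qt_supp Z.
     qt_scale (s powi (fst x * snd x) * qt_coeff Z x) (qt_theta s (g x)))"
  by (simp add: theta_map_def case_prod_beta)

lemma qt_scale_add_left: "qt_scale (c + d) P = qt_scale c P + qt_scale d P"
  by (rule poly_mapping_eqI) (simp add: lookup_add algebra_simps)

lemma qt_scale_scale [simp]: "qt_scale c (qt_scale d P) = qt_scale (c * d) P"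
  by (rule poly_mapping_eqI) (simp add: mult_ac)

lemma theta_map_add: "theta_map s g (P + Q) = theta_map s g P + theta_map s g Q"
  unfolding theta_map_alt
  by (rule qt_sum_add[where f = "\<lambda>x c. qt_scale (s powi (fst x * snd x) * c) (qt_theta s (g x))"])
     (auto simp: algebra_simps qt_scale_add_left)

lemma theta_map_single:
  "theta_map s g (qt_term (k, l) c) = qt_scale (s powi (k * l) * c) (qt_theta s (g (k, l)))"
  by (cases "c = 0") (auto simp: theta_map_def)

lemma theta_map_zero [simp]: "theta_map s g 0 = 0"
  by (simp add: theta_map_def)

lemma theta_map_scale: "theta_map s g (qt_scale c P) = qt_scale c (theta_map s g P)"
  by (induction P rule: qt_induct)
     (simp_all add: theta_map_add qt_scale_add theta_map_single mult_ac)

lemma theta_map_theta: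
  assumes "s \<noteq> 0"
  shows "theta_map s g (qt_theta s x) = qt_theta s (g x)"
proof (cases x)
  case (Pair k l)
  have "qt_scale 1 P = P" for P by (rule poly_mapping_eqI) simp
  thus ?thesis using assms unfolding Pair
    by (simp add: qt_theta_eq[of s k l] theta_map_single flip: power_int_add)
qed

lemma theta_map_mult:
  assumes "s \<noteq> 0"
    and add: "\<And>k l k' l'. g (k + k', l + l') =
          (fst (g (k, l)) + fst (g (k', l')), snd (g (k, l)) + snd (g (k', l')))"
    and det: "\<And>k l k' l'. fst (g (k, l)) * snd (g (k', l')) - snd (g (k, l)) * fst (g (k', l'))
          = k * l' - l * k'"
  shows "theta_map s g (qt_mult s P Q) = qt_mult s (theta_map s g P) (theta_map s g Q)"
proof (induction P rule: qt_induct)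
  case (single k l c)
  show ?case
  proof (induction Q rule: qt_induct)
    case (single k' l' c')
    have "qt_mult s (qt_theta s (g (k, l))) (qt_theta s (g (k', l'))) =
      qt_scale (s powi (k * l' - l * k')) (qt_theta s (g (k + k', l + l')))"
      using qt_theta_mult[OF assms(1), of "fst (g (k, l))" "snd (g (k, l))"
          "fst (g (k', l'))" "snd (g (k', l'))"]
      by (simp add: add det)
    moreover have "s powi ((k + k') * (l + l')) * s powi (- 2 * l * k') =
       s powi (k * l) * s powi (k' * l') * s powi (k * l' - l * k')"
      unfolding power_int_add[OF disjI1[OF assms(1)], symmetric]
      by (rule arg_cong[where f = "\<lambda>x. s powi x"]) (simp add: algebra_simps)
    ultimately show ?case
      by (simp add: qt_mult_single theta_map_single qt_mult_scale mult_ac)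
  qed (simp_all add: qt_mult_add_right theta_map_add)
qed (simp_all add: qt_mult_add_left theta_map_add)

lemma theta_map_comp:
  assumes "s \<noteq> 0"
  shows "theta_map s g (theta_map s h P) = theta_map s (g \<circ> h) P"
  by (induction P rule: qt_induct)
     (simp_all add: theta_map_add theta_map_single theta_map_scale theta_map_theta assms)

lemma theta_map_id:
  assumes "s \<noteq> 0"
  shows "theta_map s id P = P"
  by (induction P rule: qt_induct)
     (simp_all add: theta_map_add theta_map_single qt_theta_eq assms mult_ac flip: power_int_add)

lemma theta_map_ring_iso:
  assumes "s \<noteq> 0"
    and add: "\<And>k l k' l'. g (k + k', l + l') =
          (fst (g (k, l)) + fst (g (k', l')), snd (g (k, l)) + snd (g (k', l')))"
    and det: "\<And>k l k' l'. fst (g (k, l)) * snd (g (k', l')) - snd (g (k, l)) * fst (g (k', l'))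
          = k * l' - l * k'"
    and inv: "g \<circ> h = id" "h \<circ> g = id"
  shows "theta_map s g \<in> ring_iso (quantum_torus s) (quantum_torus s)"
proof (rule ring_iso_memI)
  have "g (0, 0) = (0, 0)" using add[of 0 0 0 0] by (cases "g (0, 0)") simp
  thus "theta_map s g \<one>\<^bsub>quantum_torus s\<^esub> = \<one>\<^bsub>quantum_torus s\<^esub>"
    by (simp add: theta_map_single qt_theta_eq assms(1))
  show "bij_betw (theta_map s g) (carrier (quantum_torus s)) (carrier (quantum_torus s))"
    by (rule bij_betw_byWitness[of _ "theta_map s h"])
       (auto simp: theta_map_comp theta_map_id assms(1) inv)
qed (auto simp: theta_map_mult[OF assms(1-3)] theta_map_add)

lemma mat_det_2:
  assumes "A \<in> carrier_mat 2 2"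
  shows "det A = A $$ (0,0) * A $$ (1,1) - A $$ (0,1) * A $$ (1,0)"
proof -
  have "det A = (\<Sum>i<2. A $$ (i, 0) * cofactor A i 0)"
    by (rule laplace_expansion_column[OF assms]) simp
  thus ?thesis using assms
    by (simp add: cofactor_def numeral_2_eq_2 det_single mat_delete_def)
qed

lemma SL2_int_det:
  assumes "A \<in> carrier (SL2 :: int mat monoid)"
  shows "A $$ (0,0) * A $$ (1,1) - A $$ (0,1) * A $$ (1,0) = 1"
  using assms mat_det_2[of A] by (simp add: SL2_def)

lemma F_plus_theta: "s \<noteq> 0 \<Longrightarrow> F_plus s A (qt_theta s (k, l)) = qt_theta s (pi1_act A (k, l))"
  by (simp add: F_plus_def theta_map_theta)

lemma F_minus_theta: "s \<noteq> 0 \<Longrightarrow> F_minus s A (qt_theta s (k, l)) = qt_theta s (pi1_act A (- k, - l))"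
  by (simp add: F_minus_def theta_map_theta)

lemma F_automorphisms:
  assumes "s \<noteq> 0" and A: "A \<in> carrier (SL2 :: int mat monoid)"
  shows "F_plus s A \<in> ring_iso (quantum_torus s) (quantum_torus s)" (is ?p)
    and "F_minus s A \<in> ring_iso (quantum_torus s) (quantum_torus s)" (is ?m)
proof -
  obtain a b c d where abcd: "A $$ (0,0) = a" "A $$ (0,1) = b" "A $$ (1,0) = c" "A $$ (1,1) = d"
    by blast
  have act: "pi1_act A (k, l) = (k * a + l * c, k * b + l * d)" for k l
    by (simp only: pi1_act_def prod.case abcd)
  have det: "a * d - b * c = 1" using SL2_int_det[OF A] by (simp only: abcd)
  have det': "a * d = 1 + b * c" using det by simp
  have e1: "k * (a * d) = k + k * (b * c)" for k using det' by (simp add: algebra_simps)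
  have cross: "(k * a + l * c) * (k' * b + l' * d) - (k * b + l * d) * (k' * a + l' * c)
        = k * l' - l * k'" for k l k' l'
  proof -
    have "(k * a + l * c) * (k' * b + l' * d) - (k * b + l * d) * (k' * a + l' * c)
        = (a * d - b * c) * (k * l' - l * k')" by (simp add: algebra_simps)
    thus ?thesis by (simp add: det)
  qed
  have i1: "(k * d - l * c) * a + (l * a - k * b) * c = k"
       "(k * d - l * c) * b + (l * a - k * b) * d = l"
       "(k * a + l * c) * d - (k * b + l * d) * c = k"
       "(k * b + l * d) * a - (k * a + l * c) * b = l" for k l
    using e1[of k] e1[of l] by (simp_all add: algebra_simps)
  show ?p unfolding F_plus_def
    apply (rule theta_map_ring_iso[OF assms(1),
          where h = "\<lambda>(k, l). (k * d - l * c, l * a - k * b)"])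
    subgoal by (simp add: act algebra_simps)
    subgoal for k l k' l' using cross[of k l k' l'] by (simp add: act)
    subgoal using i1 by (auto simp: act fun_eq_iff)
    subgoal using i1 by (auto simp: act fun_eq_iff)
    done
  show ?m unfolding F_minus_def
    apply (rule theta_map_ring_iso[OF assms(1),
          where h = "\<lambda>(k, l). (- (k * d - l * c), - (l * a - k * b))"])
    subgoal by (simp add: act algebra_simps)
    subgoal for k l k' l' using cross[of k l k' l'] by (simp add: act algebra_simps)
    subgoal using i1 by (auto simp: act fun_eq_iff algebra_simps)
    subgoal using i1 by (auto simp: act fun_eq_iff algebra_simps)
    done
qed


lemma q_half_nonzero [simp]: "q_half n \<noteq> 0"
  by (simp add: q_half_def)

lemma q_half_power: "n > 0 \<Longrightarrow> q_half n powi (2 * int n * k) = 1"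
proof -
  assume "n > 0"
  hence "q_half n ^ (2 * n) = exp (of_nat (2 * n) * (of_real pi * \<i> / of_nat n))"
    unfolding q_half_def by (simp flip: exp_of_nat_mult)
  also have "of_nat (2 * n) * (of_real pi * \<i> / of_nat n) = 2 * of_real pi * \<i>"
    using \<open>n > 0\<close> by (simp add: field_simps)
  finally have "q_half n powi int (2 * n) = 1"
    unfolding power_int_of_nat by (simp only: exp_two_pi_i)
  thus ?thesis by (simp only: power_int_mult of_nat_mult of_nat_numeral power_int_1_left)
qed

lemma rho_carrier [simp]: "rho n u v Z \<in> carrier_mat n n"
  "dim_row (rho n u v Z) = n" "dim_col (rho n u v Z) = n"
  by (simp_all add: rho_def)

lemma rho_alt: "i < n \<Longrightarrow> j < n \<Longrightarrow> rho n u v Z $$ (j, i) = (\<Sum>x\<in>qt_supp Z. qt_coeff Z x *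
     (if int j = (int i + snd x) mod int n
      then u powi fst x * v powi snd x * q_half n powi (2 * fst x * int j) else 0))"
  by (simp only: rho_def index_mat split_def fst_conv snd_conv prod.collapse)

lemma rho_add: "rho n u v (P + Q) = rho n u v P + rho n u v Q"
proof (rule eq_matI)
  fix j i assume "j < dim_row (rho n u v P + rho n u v Q)" "i < dim_col (rho n u v P + rho n u v Q)"
  hence ij: "j < n" "i < n" by simp_all
  have "rho n u v (P + Q) $$ (j, i) = rho n u v P $$ (j, i) + rho n u v Q $$ (j, i)"
    unfolding rho_alt[OF ij(2,1)]
    by (rule qt_sum_add[where f = "\<lambda>x c. c * (if int j = (int i + snd x) mod int n
      then u powi fst x * v powi snd x * q_half n powi (2 * fst x * int j) else 0)"])
       (auto simp: algebra_simps)
  thus "rho n u v (P + Q) $$ (j, i) = (rho n u v P + rho n u v Q) $$ (j, i)"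
    using ij by simp
qed simp_all

lemma rho_single:
  "rho n u v (qt_term (k, l) c) = mat n n (\<lambda>(j, i). if int j = (int i + l) mod int n
      then c * (u powi k * v powi l * q_half n powi (2 * k * int j)) else 0)"
  by (rule eq_matI; cases "c = 0") (auto simp: rho_def)

lemma rho_zero: "rho n u v 0 = 0\<^sub>m n n"
  by (rule eq_matI) (auto simp: rho_def)

lemma rho_scale: "rho n u v (qt_scale c Z) = c \<cdot>\<^sub>m rho n u v Z"
proof (induction Z rule: qt_induct)
  case (add P Q)
  thus ?case by (simp add: qt_scale_add rho_add add_smult_distrib_left_mat[of _ n n])
qed (auto intro!: eq_matI simp: rho_zero rho_single)

lemma rho_X: "rho n u v qt_X = mat n n (\<lambda>(j, i). if j = i then u * ((q_half n)\<^sup>2) ^ i else 0)"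
proof -
  have "q_half n powi (2 * int i) = ((q_half n)\<^sup>2) ^ i" for i
    by (simp add: power_int_mult)
  thus ?thesis by (intro eq_matI) (auto simp: qt_X_def rho_single)
qed

lemma rho_Y: "rho n u v qt_Y = mat n n (\<lambda>(j, i). if j = (i + 1) mod n then v else 0)"
proof -
  have "int j = (int i + 1) mod int n \<longleftrightarrow> j = (i + 1) mod n" for i j
    by (metis of_nat_Suc of_nat_eq_iff of_nat_mod add.commute Suc_eq_plus1)
  thus ?thesis by (intro eq_matI) (auto simp: qt_Y_def rho_single)
qed

lemma rho_one: "rho n u v (qt_term (0, 0) 1) = 1\<^sub>m n"
  by (intro eq_matI) (auto simp: rho_single)

lemma rho_mult_single:
  assumes "n > 0" "u \<noteq> 0" "v \<noteq> 0"
  shows "rho n u v (qt_mult (q_half n) (qt_term (k, l) c) (qt_term (k', l') c')) =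
    rho n u v (qt_term (k, l) c) * rho n u v (qt_term (k', l') c')"
proof (rule eq_matI)
  fix j i assume "j < dim_row (rho n u v (qt_term (k, l) c) * rho n u v (qt_term (k', l') c'))"
    "i < dim_col (rho n u v (qt_term (k, l) c) * rho n u v (qt_term (k', l') c'))"
  hence ij: "j < n" "i < n" by simp_all
  define m where "m = nat ((int i + l') mod int n)"
  have m: "int m = (int i + l') mod int n" "m < n"
    using assms(1) by (auto simp: m_def nat_less_iff)
  have mu: "int r = (int i + l') mod int n \<longleftrightarrow> r = m" for r
    unfolding m(1)[symmetric] by simp
  have "(int m + l) mod int n = (int i + l' + l) mod int n"
    unfolding m(1) by (rule mod_add_left_eq)
  hence ml: "(int m + l) mod int n = (int i + (l + l')) mod int n"
    by (simp only: add.assoc add.commute[of l l'])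
  let ?q = "q_half n"
  let ?A = "\<lambda>r. if int j = (int r + l) mod int n
      then c * (u powi k * v powi l * ?q powi (2 * k * int j)) else 0"
  have "(rho n u v (qt_term (k, l) c) * rho n u v (qt_term (k', l') c')) $$ (j, i) =
    (\<Sum>r<n. ?A r * (if r = m
      then c' * (u powi k' * v powi l' * ?q powi (2 * k' * int r)) else 0))"
    using ij by (auto simp: rho_single scalar_prod_def mu atLeast0LessThan intro!: sum.cong)
  also have "\<dots> = (\<Sum>r<n. if r = m
      then ?A m * (c' * (u powi k' * v powi l' * ?q powi (2 * k' * int m))) else 0)"
    by (rule sum.cong) auto
  also have "\<dots> = ?A m * (c' * (u powi k' * v powi l' * ?q powi (2 * k' * int m)))"
    using m(2) by simp
  also have "\<dots> = rho n u v (qt_mult ?q (qt_term (k, l) c) (qt_term (k', l') c')) $$ (j, i)"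
  proof (cases "int j = (int m + l) mod int n")
    case True
    hence "int j mod int n = (int m + l) mod int n" by simp
    hence "int n dvd int j - (int m + l)" by (simp only: mod_eq_dvd_iff)
    then obtain t where t: "int j = int m + l + int n * t"
      by (metis dvdE diff_add_cancel add.commute)
    have "?q powi (- 2 * l * k') * ?q powi (2 * (k + k') * int j) =
      ?q powi ((2 * k * int j + 2 * k' * int m) + 2 * int n * (k' * t))"
      unfolding power_int_add[OF disjI1[OF q_half_nonzero], symmetric]
      by (rule arg_cong[where f = "\<lambda>x. ?q powi x"]) (simp add: algebra_simps t)
    also have "\<dots> = ?q powi (2 * k * int j) * ?q powi (2 * k' * int m)"
      by (simp only: power_int_add[OF disjI1[OF q_half_nonzero]] q_half_power[OF assms(1)] mult_1_right)
    finally have e: "?q powi (- 2 * l * k') * ?q powi (2 * (k + k') * int j) =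
       ?q powi (2 * k * int j) * ?q powi (2 * k' * int m)" .
    have j: "int j = (int i + (l + l')) mod int n"
      using True ml by simp
    have "rho n u v (qt_mult ?q (qt_term (k, l) c) (qt_term (k', l') c')) $$ (j, i) =
      c * c' * (u powi (k + k') * v powi (l + l')) *
        (?q powi (- 2 * l * k') * ?q powi (2 * (k + k') * int j))"
      using ij by (simp add: qt_mult_single rho_single flip: j)
    thus ?thesis unfolding e using True assms by (simp add: power_int_add mult_ac)
  next
    case False
    thus ?thesis using ij ml by (simp add: qt_mult_single rho_single)
  qed
  finally show "rho n u v (qt_mult ?q (qt_term (k, l) c) (qt_term (k', l') c')) $$ (j, i) =
    (rho n u v (qt_term (k, l) c) * rho n u v (qt_term (k', l') c')) $$ (j, i)" ..
qed simp_all

lemma rho_mult: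
  assumes "n > 0" "u \<noteq> 0" "v \<noteq> 0"
  shows "rho n u v (qt_mult (q_half n) P Q) = rho n u v P * rho n u v Q"
proof (induction P rule: qt_induct)
  case (single k l c)
  show ?case
  proof (induction Q rule: qt_induct)
    case (add Q Q')
    thus ?case
      by (simp add: qt_mult_add_right rho_add mult_add_distrib_mat[of _ n n _ n])
  qed (simp_all add: rho_zero rho_mult_single[OF assms] right_mult_zero_mat[of _ n n])
next
  case (add P P')
  thus ?case by (simp add: qt_mult_add_left rho_add add_mult_distrib_mat[of _ n n _ _ n])
qed (simp_all add: rho_zero left_mult_zero_mat[of _ n n])

lemma rho_ring_hom:
  assumes "n > 0" "u \<noteq> 0" "v \<noteq> 0"
  shows "rho n u v \<in> Ring.ring_hom (quantum_torus (q_half n)) (ring_mat TYPE(complex) n ())"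
  by (rule ring_hom_memI) (simp_all add: ring_mat_simps rho_mult[OF assms] rho_add rho_one)

end

theory Submission
  imports Defs
begin

text \<open>
The quantum torus acts on \<open>\<complex>\<^sup>n\<close> through the Weyl operators \<open>W(x)\<close>, the images of the elements
\<open>\<theta>\<^sub>x\<close> with \<open>x \<in> \<int>\<^sup>2\<close>.  They multiply like group elements up to powers of \<open>q\<^bsup>1/2\<^esup>\<close>, they are
scalar on \<open>n\<int>\<^sup>2\<close>, and an intertwiner \<open>L\<close> satisfies \<open>L W(x) L\<^bsup>-1\<^esup> = W(gx)\<close>, where \<open>g\<close> is \<open>A\<close>
or \<open>-A\<close> acting on row vectors.

\<^emph>\<open>Upper bound.\<close>  Write \<open>t(k, l) = |u|\<^sup>k|v|\<^sup>l\<close>.  Up to the factor \<open>t(x)\<close> each \<open>W(x)\<close> is unitary.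
Since \<open>W(nx)\<close> is a scalar of modulus \<open>t(x)\<^sup>n\<close> and conjugation fixes scalars, \<open>t(gx) = t(x)\<close>.
Hence \<open>L\<^sup>*L\<close> commutes with all Weyl operators, so it is a scalar by Schur's lemma, and
\<open>|det L| = 1\<close> makes it the identity.  A unitary matrix has \<open>|Trace L| \<le> n\<close>
(\<open>unitary\<close>, \<open>cmod_trace_le\<close>), which is subexponential.

\<^emph>\<open>Lower bound.\<close>  The \<open>n\<^sup>2\<close> conjugates of a matrix \<open>M\<close> by Weyl operators add up to the
scalar matrix \<open>n Trace M\<close>.  For \<open>M = L\<close>, multiplied by \<open>L\<^bsup>-1\<^esup>\<close> and traced, this reads
\<open>n Trace L Trace L\<^bsup>-1\<^esup> = \<Sum>\<^sub>x Trace (W(x) W(-gx))\<close>, the sum being over \<open>(\<int>/n)\<^sup>2\<close>.  A summand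
vanishes unless \<open>gx \<equiv> x\<close> modulo \<open>n\<close>.  If moreover every fixed point modulo \<open>n\<close> lifts to a fixed
point of \<open>g\<close> in \<open>\<int>\<^sup>2\<close>, then \<open>W(gx) = W(x)\<close> for all these \<open>x\<close> and their summands equal \<open>n\<close>; as
\<open>L\<close> is unitary, \<open>|Trace L|\<^sup>2\<close> is the number of fixed points of \<open>g\<close> on \<open>(\<int>/n)\<^sup>2\<close>, which is at
least one (\<open>trace_product\<close>, \<open>one_le_cmod_trace\<close>).  The lifting holds for all \<open>n\<close> coprime to some
nonzero integer \<open>e\<close> that depends on \<open>g\<close> alone (\<open>fixed_points_lift_coprime\<close>), in particular for
the infinitely many odd numbers \<open>n = 2|e|m + 1\<close>.  Along these, the quotient is nonnegative, and
the limit superior is \<open>0\<close>.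
\<close>


section \<open>Traces and conjugate transposes\<close>

abbreviation ctranspose :: "complex mat \<Rightarrow> complex mat" where
  "ctranspose M \<equiv> map_mat cnj (transpose_mat M)"

lemma cnj_mult_self: "cnj z * z = of_real ((cmod z)\<^sup>2)"
  by (metis complex_norm_square mult.commute)

lemma mat_trace_smult: "mat_trace (c \<cdot>\<^sub>m M) = c * mat_trace M"
  if "M \<in> carrier_mat n n" for c :: "'a::comm_ring_1"
  using that by (auto simp: mat_trace_def sum_distrib_left)

lemma mat_trace_ctranspose: "mat_trace (ctranspose M) = cnj (mat_trace M)"
  if "M \<in> carrier_mat n n"
  using that by (auto simp: mat_trace_def)

lemma ctranspose_mult:
  assumes "M \<in> carrier_mat n m" "N \<in> carrier_mat m p"
  shows "ctranspose (M * N) = ctranspose N * ctranspose M"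
  using assms by (intro eq_matI) (auto simp: scalar_prod_def mult.commute)

lemma det_ctranspose: "det (ctranspose M) = cnj (det M)" if "M \<in> carrier_mat n n"
proof -
  interpret cnj: comm_ring_hom cnj by standard auto
  show ?thesis using that by (simp add: cnj.hom_det det_transpose)
qed

section \<open>Sums over residues\<close>

lemma q_half_powi_eq_1_iff:
  assumes "n > 0"
  shows "q_half n powi (2 * m) = 1 \<longleftrightarrow> int n dvd m"
proof
  assume "q_half n powi (2 * m) = 1"
  moreover have "q_half n powi (2 * m) = exp (of_int (2 * m) * (of_real pi * \<i> / of_nat n))"
    unfolding q_half_def by (rule exp_power_int)
  ultimately have "exp (of_int (2 * m) * (of_real pi * \<i> / of_nat n)) = 1" by simp
  hence "Re (exp (of_int (2 * m) * (of_real pi * \<i> / of_nat n))) = 1" by simp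
  hence "cos (2 * real_of_int m * pi / real n) = 1" by (simp add: Re_exp mult_ac)
  then obtain r :: int where "2 * real_of_int m * pi / real n = of_int r * 2 * pi"
    by (auto simp: cos_one_2pi_int)
  hence "real_of_int m = real_of_int (int n * r)" using assms by (simp add: field_simps)
  hence "m = int n * r" by (simp only: of_int_eq_iff)
  thus "int n dvd m" by simp
next
  assume "int n dvd m"
  then obtain r where "m = int n * r" ..
  thus "q_half n powi (2 * m) = 1" using q_half_power[OF assms, of r] by (simp add: mult.assoc)
qed

lemma q_half_powi_cong:
  assumes "n > 0" "i mod int n = j mod int n"
  shows "q_half n powi (2 * k * i) = q_half n powi (2 * k * j)"
proof -
  obtain r where r: "i = j + int n * r"
    using assms(2) by (metis add.commute diff_add_cancel mod_eq_dvd_iff dvdE)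
  have "q_half n powi (2 * k * i) = q_half n powi (2 * k * j) * q_half n powi (2 * int n * (k * r))"
    unfolding power_int_add[OF disjI1[OF q_half_nonzero], symmetric]
    by (rule arg_cong[where f = "\<lambda>x. _ powi x"]) (simp add: r algebra_simps)
  thus ?thesis by (simp only: q_half_power[OF assms(1)] mult_1_right)
qed

text \<open>
Orthogonality of the characters of \<open>\<int>/n\<close>: the sum is geometric with ratio the \<open>n\<close>-th root of
unity \<open>q\<^sup>m\<close>.
\<close>

lemma q_half_character_sum:
  assumes "n > 0"
  shows "(\<Sum>k<n. q_half n powi (2 * int k * m)) = (if int n dvd m then of_nat n else 0)"
proof -
  have e: "q_half n powi (2 * int k * m) = (q_half n powi (2 * m)) ^ k" for k
  proof -
    have "2 * int k * m = 2 * m * int k" by simp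
    thus ?thesis by (simp only: power_int_mult power_int_of_nat)
  qed
  show ?thesis
  proof (cases "int n dvd m")
    case True
    hence "q_half n powi (2 * m) = 1" by (simp only: q_half_powi_eq_1_iff[OF assms])
    thus ?thesis using True by (simp only: e power_one) simp
  next
    case False
    have "(q_half n powi (2 * m)) ^ n = 1"
      using q_half_power[OF assms, of m] by (simp only: e[symmetric])
    thus ?thesis using False
      by (simp add: e sum_gp_strict q_half_powi_eq_1_iff[OF assms])
  qed
qed

lemma sum_cyclic_reflect:
  fixes f :: "nat \<Rightarrow> 'a::comm_monoid_add"
  assumes "n > 0"
  shows "(\<Sum>l<n. f (nat ((j - int l) mod int n))) = (\<Sum>l<n. f l)"
proof (rule sum.reindex_bij_witness[where i = "\<lambda>l. nat ((j - int l) mod int n)"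
      and j = "\<lambda>l. nat ((j - int l) mod int n)"])
  have inv: "nat ((j - int (nat ((j - int l) mod int n))) mod int n) = l" if "l < n" for l
    using that assms by (simp add: mod_diff_right_eq)
  show "nat ((j - int (nat ((j - int l) mod int n))) mod int n) = l" if "l \<in> {..<n}" for l
    using inv that by simp
  show "nat ((j - int (nat ((j - int l) mod int n))) mod int n) = l" if "l \<in> {..<n}" for l
    using inv that by simp
qed (use assms in \<open>auto simp: nat_less_iff\<close>)

lemma sum_swap_pairs:
  fixes F :: "'a \<Rightarrow> 'b \<Rightarrow> 'c \<Rightarrow> 'd \<Rightarrow> 'e::comm_monoid_add"
  shows "(\<Sum>k\<in>A. \<Sum>l\<in>B. \<Sum>j\<in>C. \<Sum>i\<in>D. F k l j i) = (\<Sum>j\<in>C. \<Sum>i\<in>D. \<Sum>k\<in>A. \<Sum>l\<in>B. F k l j i)"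
proof -
  have "(\<Sum>l\<in>B. \<Sum>j\<in>C. \<Sum>i\<in>D. F k l j i) = (\<Sum>j\<in>C. \<Sum>i\<in>D. \<Sum>l\<in>B. F k l j i)" for k
    by (subst sum.swap) (rule sum.cong[OF refl], rule sum.swap)
  hence "(\<Sum>k\<in>A. \<Sum>l\<in>B. \<Sum>j\<in>C. \<Sum>i\<in>D. F k l j i) = (\<Sum>k\<in>A. \<Sum>j\<in>C. \<Sum>i\<in>D. \<Sum>l\<in>B. F k l j i)"
    by simp
  also have "\<dots> = (\<Sum>j\<in>C. \<Sum>i\<in>D. \<Sum>k\<in>A. \<Sum>l\<in>B. F k l j i)"
    by (subst sum.swap) (rule sum.cong[OF refl], rule sum.swap)
  finally show ?thesis .
qed

section \<open>Weyl operators\<close>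

definition weyl :: "nat \<Rightarrow> complex \<Rightarrow> complex \<Rightarrow> int \<Rightarrow> int \<Rightarrow> complex mat" where
  "weyl n u v k l = rho n u v (qt_theta (q_half n) (k, l))"

lemma weyl_carrier [simp]: "weyl n u v k l \<in> carrier_mat n n"
  "dim_row (weyl n u v k l) = n" "dim_col (weyl n u v k l) = n"
  by (simp_all add: weyl_def)

locale weyl_system =
  fixes n :: nat and u v :: complex
  assumes n_pos: "n > 0" and u_nz: "u \<noteq> 0" and v_nz: "v \<noteq> 0"
begin

abbreviation W :: "int \<Rightarrow> int \<Rightarrow> complex mat" where "W \<equiv> weyl n u v"

abbreviation s :: complex where "s \<equiv> q_half n"

text \<open>
Rows and columns are indexed by \<open>\<int>/n\<close>; \<open>res i\<close> is the representative of the class of \<open>i\<close> that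
is an admissible index.
\<close>

abbreviation res :: "int \<Rightarrow> nat" where "res i \<equiv> nat (i mod int n)"

lemma res_less [simp]: "res i < n"
  using n_pos by (simp add: nat_less_iff)

lemma int_res: "int (res i) = i mod int n"
  using n_pos by simp

lemma weyl_index:
  assumes "j < n" "i < n"
  shows "W k l $$ (j, i) = (if int j = (int i + l) mod int n
    then s powi (- k * l) * (u powi k * v powi l * s powi (2 * k * int j)) else 0)"
  using assms by (simp add: weyl_def qt_theta_eq rho_single)

lemma weyl_mult:
  "W k l * W k' l' = s powi (k * l' - l * k') \<cdot>\<^sub>m W (k + k') (l + l')"
  unfolding weyl_def rho_mult[OF n_pos u_nz v_nz, symmetric] qt_theta_mult[OF q_half_nonzero]
    rho_scale ..

lemma weyl_zero: "W 0 0 = 1\<^sub>m n"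
  by (simp add: weyl_def qt_theta_eq rho_one)

lemma weyl_mult_minus: "W k l * W (- k) (- l) = 1\<^sub>m n" "W (- k) (- l) * W k l = 1\<^sub>m n"
  by (simp_all add: weyl_mult weyl_zero) (auto intro!: eq_matI)

text \<open>
A Weyl operator has one nonzero entry in each row and column, so multiplying by it only shifts the
rows or columns and rescales them.
\<close>

lemma weyl_left_index:
  assumes "M \<in> carrier_mat n n" "j < n" "i < n"
  shows "(W k l * M) $$ (j, i) = s powi (- k * l) * (u powi k * v powi l * s powi (2 * k * int j))
    * M $$ (res (int j - l), i)"
proof -
  have iff: "int j = (int r + l) mod int n \<longleftrightarrow> r = res (int j - l)" if "r < n" for r
  proof
    assume "int j = (int r + l) mod int n"
    hence "(int j - l) mod int n = int r mod int n" by (simp add: mod_diff_left_eq)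
    thus "r = res (int j - l)" using that by simp
  next
    assume "r = res (int j - l)"
    hence "int r = (int j - l) mod int n" by (simp only: int_res)
    hence "(int r + l) mod int n = int j mod int n" by (simp add: mod_add_left_eq)
    thus "int j = (int r + l) mod int n" using assms by simp
  qed
  have "(W k l * M) $$ (j, i) = (\<Sum>r<n. W k l $$ (j, r) * M $$ (r, i))"
    using assms by (auto simp: scalar_prod_def atLeast0LessThan intro!: sum.cong)
  also have "\<dots> = (\<Sum>r<n. if r = res (int j - l) then
      s powi (- k * l) * (u powi k * v powi l * s powi (2 * k * int j)) * M $$ (r, i) else 0)"
    using assms by (intro sum.cong) (auto simp: weyl_index iff)
  finally show ?thesis by simp
qed

lemma weyl_right_index:
  assumes "M \<in> carrier_mat n n" "j < n" "i < n"
  shows "(M * W k l) $$ (j, i) = M $$ (j, res (int i + l)) *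
    (s powi (- k * l) * (u powi k * v powi l * s powi (2 * k * (int i + l))))"
proof -
  have iff: "int r = (int i + l) mod int n \<longleftrightarrow> r = res (int i + l)" for r
    by (metis int_res nat_int)
  have "(M * W k l) $$ (j, i) = (\<Sum>r<n. M $$ (j, r) * W k l $$ (r, i))"
    using assms by (auto simp: scalar_prod_def atLeast0LessThan intro!: sum.cong)
  also have "\<dots> = (\<Sum>r<n. if r = res (int i + l) then M $$ (j, r) *
      (s powi (- k * l) * (u powi k * v powi l * s powi (2 * k * int r))) else 0)"
    using assms by (intro sum.cong) (auto simp: weyl_index iff)
  also have "\<dots> = M $$ (j, res (int i + l)) *
      (s powi (- k * l) * (u powi k * v powi l * s powi (2 * k * int (res (int i + l)))))"
    by simp
  also have "s powi (2 * k * int (res (int i + l))) = s powi (2 * k * (int i + l))"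
    by (rule q_half_powi_cong[OF n_pos]) (simp only: int_res mod_mod_trivial)
  finally show ?thesis .
qed

text \<open>
If \<open>n\<close> does not divide \<open>l\<close>, the diagonal of \<open>W k l\<close> is zero; if \<open>n\<close> divides \<open>l\<close> but not \<open>k\<close>, it
is a multiple of a nontrivial character of \<open>\<int>/n\<close>.
\<close>

lemma mat_trace_weyl:
  assumes "\<not> (int n dvd k \<and> int n dvd l)"
  shows "mat_trace (W k l) = 0"
proof -
  have iff: "int j = (int j + l) mod int n \<longleftrightarrow> int n dvd l" if "j < n" for j
    using that by (metis add_diff_cancel_left' mod_eq_dvd_iff mod_less of_nat_mod)
  have "mat_trace (W k l) = (\<Sum>j<n. if int n dvd l
      then s powi (- k * l) * (u powi k * v powi l) * s powi (2 * int j * k) else 0)"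
    by (auto simp: mat_trace_def weyl_index iff mult_ac intro!: sum.cong)
  also have "\<dots> = (if int n dvd l then s powi (- k * l) * (u powi k * v powi l) *
      (\<Sum>j<n. s powi (2 * int j * k)) else 0)"
    by (simp add: sum_distrib_left)
  also have "\<dots> = 0" using assms by (simp add: q_half_character_sum[OF n_pos])
  finally show ?thesis .
qed

lemma weyl_multiple:
  "W (int n * k) (int n * l) =
    (s powi (- (int n * k) * (int n * l)) * (u powi (int n * k) * v powi (int n * l))) \<cdot>\<^sub>m 1\<^sub>m n"
proof -
  define c where "c = s powi (- (int n * k) * (int n * l)) * (u powi (int n * k) * v powi (int n * l))"
  have "W (int n * k) (int n * l) = c \<cdot>\<^sub>m 1\<^sub>m n"
  proof (rule eq_matI)
    fix j i
    assume "j < dim_row (c \<cdot>\<^sub>m 1\<^sub>m n)" "i < dim_col (c \<cdot>\<^sub>m 1\<^sub>m n)"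
    hence ij: "j < n" "i < n" by simp_all
    have q: "s powi (2 * (int n * k) * int j) = 1"
      using q_half_power[OF n_pos, of "k * int j"] by (simp only: mult.assoc)
    have iff: "int j = (int i + int n * l) mod int n \<longleftrightarrow> j = i"
      using ij by simp
    show "W (int n * k) (int n * l) $$ (j, i) = (c \<cdot>\<^sub>m 1\<^sub>m n) $$ (j, i)"
      unfolding weyl_index[OF ij] iff q using ij by (simp add: c_def mult.assoc)
  qed simp_all
  thus ?thesis unfolding c_def .
qed

lemma weyl_conj_index:
  assumes "M \<in> carrier_mat n n" "j < n" "i < n"
  shows "(W k l * M * W (- k) (- l)) $$ (j, i) =
    s powi (2 * k * (int j - int i)) * M $$ (res (int j - l), res (int i - l))"
proof -
  have e: "s powi (- k * l) * s powi (2 * k * int j) *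
      (s powi (- (- k) * - l) * s powi (2 * - k * (int i + - l))) = s powi (2 * k * (int j - int i))"
    unfolding power_int_add[OF disjI1[OF q_half_nonzero], symmetric]
    by (rule arg_cong[where f = "\<lambda>x. _ powi x"]) (simp add: algebra_simps)
  have "(W k l * M * W (- k) (- l)) $$ (j, i) =
    (W k l * M) $$ (j, res (int i + - l)) *
    (s powi (- (- k) * - l) * (u powi (- k) * v powi (- l) * s powi (2 * - k * (int i + - l))))"
    using assms by (intro weyl_right_index mult_carrier_mat[of _ n n]) auto
  also have "(W k l * M) $$ (j, res (int i + - l)) =
      s powi (- k * l) * (u powi k * v powi l * s powi (2 * k * int j))
      * M $$ (res (int j - l), res (int i + - l))"
    using assms by (intro weyl_left_index) auto
  also have "\<dots> * (s powi (- (- k) * - l) *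
      (u powi (- k) * v powi (- l) * s powi (2 * - k * (int i + - l)))) =
    (s powi (- k * l) * s powi (2 * k * int j) *
      (s powi (- (- k) * - l) * s powi (2 * - k * (int i + - l)))) *
    (u powi k * u powi (- k)) * (v powi l * v powi (- l)) * M $$ (res (int j - l), res (int i + - l))"
    by (simp only: mult_ac)
  also have "u powi k * u powi (- k) = 1"
    using u_nz by (simp add: power_int_minus)
  also have "v powi l * v powi (- l) = 1"
    using v_nz by (simp add: power_int_minus)
  finally show ?thesis unfolding e by simp
qed

text \<open>
Conjugation by \<open>W k l\<close> shifts a matrix along its diagonals by \<open>l\<close> and multiplies the entry at
\<open>(j, i)\<close> by \<open>q\<^bsup>k(j-i)\<^esup>\<close>.  Summing over \<open>k\<close> kills the off-diagonal entries, and summing over \<open>l\<close>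
turns each diagonal entry into the trace.  This one identity yields both Schur's lemma and the trace
formula for intertwiners.
\<close>

lemma weyl_twirl:
  assumes "M \<in> carrier_mat n n" "j < n" "i < n"
  shows "(\<Sum>k<n. \<Sum>l<n. (W (int k) (int l) * M * W (- int k) (- int l)) $$ (j, i)) =
    (if i = j then of_nat n * mat_trace M else 0)"
proof -
  have dvd: "int n dvd int j - int i \<longleftrightarrow> i = j"
    using assms by (auto simp flip: mod_eq_dvd_iff)
  have "(\<Sum>k<n. \<Sum>l<n. (W (int k) (int l) * M * W (- int k) (- int l)) $$ (j, i)) =
    (\<Sum>k<n. s powi (2 * int k * (int j - int i))) *
    (\<Sum>l<n. M $$ (res (int j - int l), res (int i - int l)))"
    unfolding weyl_conj_index[OF assms] by (rule sum_product[symmetric])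
  also have "\<dots> = (if i = j then of_nat n * (\<Sum>l<n. M $$ (res (int j - int l), res (int j - int l))) else 0)"
    by (simp add: q_half_character_sum[OF n_pos] dvd)
  also have "(\<Sum>l<n. M $$ (res (int j - int l), res (int j - int l))) = mat_trace M"
    using sum_cyclic_reflect[OF n_pos, of "\<lambda>r. M $$ (r, r)" "int j"] assms(1)
    by (simp add: mat_trace_def)
  finally show ?thesis .
qed

text \<open>
Each of the \<open>n\<^sup>2\<close> conjugates of \<open>M\<close> is \<open>M\<close>, so the twirl of \<open>M\<close> is \<open>n\<^sup>2M\<close>.
\<close>

lemma weyl_schur:
  assumes M: "M \<in> carrier_mat n n" and comm: "\<And>k l. W k l * M = M * W k l"
  shows "M = (mat_trace M / of_nat n) \<cdot>\<^sub>m 1\<^sub>m n"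
proof (rule eq_matI)
  fix j i
  assume "j < dim_row ((mat_trace M / of_nat n) \<cdot>\<^sub>m 1\<^sub>m n)"
    "i < dim_col ((mat_trace M / of_nat n) \<cdot>\<^sub>m 1\<^sub>m n)"
  hence ij: "j < n" "i < n" by simp_all
  have "W k l * M * W (- k) (- l) = M" for k l
    using M by (simp add: comm assoc_mult_mat[of M n n _ n _ n] weyl_mult_minus)
  hence "of_nat n * of_nat n * M $$ (j, i) = (if i = j then of_nat n * mat_trace M else 0)"
    using weyl_twirl[OF M ij] by (simp add: mult.assoc)
  thus "M $$ (j, i) = ((mat_trace M / of_nat n) \<cdot>\<^sub>m 1\<^sub>m n) $$ (j, i)"
    using ij n_pos by (auto simp: field_simps split: if_splits)
qed (use M in simp_all)

text \<open>
For \<open>|u| = |v| = 1\<close> this is unitarity of \<open>W k l\<close>.  The general case is needed when \<open>1\<close> is an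
eigenvalue of \<open>g\<close>, for then the eigenvalues of the character need not lie on the unit circle.
\<close>

lemma ctranspose_weyl:
  "ctranspose (W k l) = of_real ((cmod u powi k * cmod v powi l)\<^sup>2) \<cdot>\<^sub>m W (- k) (- l)"
proof (rule eq_matI)
  fix j i
  assume "j < dim_row (of_real ((cmod u powi k * cmod v powi l)\<^sup>2) \<cdot>\<^sub>m W (- k) (- l))"
    "i < dim_col (of_real ((cmod u powi k * cmod v powi l)\<^sup>2) \<cdot>\<^sub>m W (- k) (- l))"
  hence ij: "j < n" "i < n" by simp_all
  have iff: "int i = (int j + l) mod int n \<longleftrightarrow> int j = (int i + - l) mod int n"
  proof
    assume "int i = (int j + l) mod int n"
    hence "(int i + - l) mod int n = int j mod int n" by (simp add: mod_diff_left_eq)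
    thus "int j = (int i + - l) mod int n" using ij by simp
  next
    assume "int j = (int i + - l) mod int n"
    hence "(int j + l) mod int n = int i mod int n" by (simp add: mod_add_left_eq)
    thus "int i = (int j + l) mod int n" using ij by simp
  qed
  have cnj_pow: "cnj (w powi m) = of_real ((cmod w powi m)\<^sup>2) * w powi (- m)" if "w \<noteq> 0" for w m
  proof -
    have "cnj (w powi m) * w powi m = of_real ((cmod w powi m)\<^sup>2)"
      by (metis complex_norm_square mult.commute norm_power_int)
    thus ?thesis using that by (simp add: power_int_minus field_simps)
  qed
  have "cmod s = 1" by (simp add: q_half_def norm_exp_eq_Re)
  hence cnj_s: "cnj (s powi m) = s powi (- m)" for m
    using cnj_pow[OF q_half_nonzero, of n m] by (simp add: norm_power_int)
  show "ctranspose (W k l) $$ (j, i) =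
      (of_real ((cmod u powi k * cmod v powi l)\<^sup>2) \<cdot>\<^sub>m W (- k) (- l)) $$ (j, i)"
  proof (cases "int i = (int j + l) mod int n")
    case True
    have "s powi (2 * - k * int j) = s powi (2 * - k * (int i - l))"
      using True iff ij by (intro q_half_powi_cong[OF n_pos]) simp
    hence e: "s powi (- (- k) * - l) * s powi (2 * - k * int j)
        = s powi (- (- k * l)) * s powi (- (2 * k * int i))"
      by (simp add: algebra_simps flip: power_int_add)
    have "ctranspose (W k l) $$ (j, i) = of_real ((cmod u powi k * cmod v powi l)\<^sup>2) *
       (u powi (- k) * v powi (- l) * (s powi (- (- k * l)) * s powi (- (2 * k * int i))))"
      using ij True by (simp add: weyl_index[of i j] cnj_s cnj_pow u_nz v_nz power_mult_distrib
          del: complex_cnj_power_int mult_minus_left minus_minus)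
    also have "\<dots> = of_real ((cmod u powi k * cmod v powi l)\<^sup>2) *
       (s powi (- (- k) * - l) * (u powi (- k) * v powi (- l) * s powi (2 * - k * int j)))"
      unfolding e[symmetric] by (simp only: mult_ac)
    also have "s powi (- (- k) * - l) * (u powi (- k) * v powi (- l) * s powi (2 * - k * int j))
        = W (- k) (- l) $$ (j, i)"
      unfolding weyl_index[OF ij] by (rule if_P[symmetric]) (use True iff in blast)
    finally show ?thesis using ij by simp
  next
    case False
    thus ?thesis using ij iff by (simp add: weyl_index)
  qed
qed simp_all

end

section \<open>Fixed points modulo an integer\<close>

text \<open>
The row vectors fixed by the matrix with rows \<open>(a, b)\<close> and \<open>(c, d)\<close> modulo \<open>N\<close> are the reductions of
the integer vectors fixed by it.
\<close>

definition fixed_points_lift :: "int \<Rightarrow> int \<Rightarrow> int \<Rightarrow> int \<Rightarrow> int \<Rightarrow> bool" where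
  "fixed_points_lift a b c d N \<longleftrightarrow> (\<forall>k l. N dvd k * a + l * c - k \<longrightarrow> N dvd k * b + l * d - l \<longrightarrow>
     (\<exists>f g k' l'. k = f + N * k' \<and> l = g + N * l' \<and> f * a + g * c = f \<and> f * b + g * d = g))"

text \<open>
It is enough that \<open>e x\<close> lifts whenever \<open>x\<close> is fixed modulo \<open>N\<close>: if \<open>r e + t N = 1\<close>, then
\<open>x = r (e x) + N (t x)\<close> lifts as well.  Let \<open>g\<close> be the matrix and \<open>B = g - 1\<close>.  If \<open>B\<close> is
invertible over \<open>\<rat>\<close>, take \<open>e = det B\<close>, and Cramer's rule gives \<open>e x \<in> N\<int>\<^sup>2\<close>.  Otherwise \<open>g\<close> is
parabolic or the identity; then \<open>B\<close> has rank at most one, and any nonzero entry of \<open>B\<close> serves as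
\<open>e\<close>, because eliminating with this entry as pivot writes \<open>e x\<close> as a kernel vector plus a multiple
of \<open>N\<close>.  If \<open>B = 0\<close>, all vectors are fixed and \<open>e = 1\<close>.
\<close>

lemma fixed_points_lift_coprime:
  fixes a b c d :: int
  assumes det: "a * d - b * c = 1"
  obtains e :: int where "e \<noteq> 0"
    "\<And>N. coprime e N \<Longrightarrow> fixed_points_lift a b c d N"
proof -
  have ex: "\<exists>e. e \<noteq> 0 \<and> (\<forall>N k l. N dvd k * a + l * c - k \<longrightarrow> N dvd k * b + l * d - l \<longrightarrow>
      (\<exists>f g k' l'. e * k = f + N * k' \<and> e * l = g + N * l' \<and> f * a + g * c = f \<and> f * b + g * d = g))"
    (is "\<exists>e. e \<noteq> 0 \<and> (\<forall>N k l. _ \<longrightarrow> _ \<longrightarrow> ?P e N k l)")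
  proof (cases "a + d = 2")
    case False
    show ?thesis
    proof (rule exI[of _ "2 - (a + d)"], intro conjI allI impI)
      show "2 - (a + d) \<noteq> 0" using False by simp
      fix N k l assume "N dvd k * a + l * c - k" "N dvd k * b + l * d - l"
      then obtain y z where yz: "k * a + l * c - k = N * y" "k * b + l * d - l = N * z"
        by (auto elim!: dvdE)
      \<comment> \<open>Cramer: the left-hand side is the determinant of \<open>g - 1\<close>.\<close>
      have D: "2 - (a + d) = (a - 1) * (d - 1) - b * c" using det by (simp add: algebra_simps)
      have "(2 - (a + d)) * k = (k * a + l * c - k) * (d - 1) - (k * b + l * d - l) * c"
        "(2 - (a + d)) * l = (k * b + l * d - l) * (a - 1) - (k * a + l * c - k) * b"
        unfolding D by (simp_all add: algebra_simps)
      hence "(2 - (a + d)) * k = 0 + N * (y * (d - 1) - z * c)"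
        "(2 - (a + d)) * l = 0 + N * (z * (a - 1) - y * b)"
        unfolding yz by (simp_all add: algebra_simps)
      thus "?P (2 - (a + d)) N k l"
        by (intro exI[of _ 0] exI[of _ "y * (d - 1) - z * c"] exI[of _ "z * (a - 1) - y * b"]) simp
    qed
  next
    case True
    hence d: "d = 2 - a" by simp
    have "b * c = (a - 1) * (1 - a)" using det unfolding d by (simp add: algebra_simps)
    hence pq: "m * (b * c) = m * ((a - 1) * (1 - a))" for m by simp
    consider "a \<noteq> 1" | "b \<noteq> 0" | "c \<noteq> 0" | "a = 1" "b = 0" "c = 0" by blast
    thus ?thesis
    proof cases
      case 1
      show ?thesis
      proof (rule exI[of _ "a - 1"], intro conjI allI impI)
        fix N k l assume "N dvd k * a + l * c - k" "N dvd k * b + l * d - l"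
        then obtain y where y: "k * a + l * c - k = N * y" by (auto elim!: dvdE)
        show "?P (a - 1) N k l"
          apply (rule exI[of _ "- l * c"], rule exI[of _ "l * (a - 1)"],
            rule exI[of _ y], rule exI[of _ 0])
          using y pq[of l] unfolding d by (simp add: algebra_simps)
      qed (use 1 in simp)
    next
      case 2
      show ?thesis
      proof (rule exI[of _ b], intro conjI allI impI)
        fix N k l assume "N dvd k * a + l * c - k" "N dvd k * b + l * d - l"
        then obtain y where y: "k * b + l * d - l = N * y" by (auto elim!: dvdE)
        show "?P b N k l"
          apply (rule exI[of _ "l * (a - 1)"], rule exI[of _ "l * b"],
            rule exI[of _ y], rule exI[of _ 0])
          using y pq[of l] unfolding d by (simp add: algebra_simps)
      qed (use 2 in simp)
    next
      case 3
      show ?thesis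
      proof (rule exI[of _ c], intro conjI allI impI)
        fix N k l assume "N dvd k * a + l * c - k" "N dvd k * b + l * d - l"
        then obtain y where y: "k * a + l * c - k = N * y" by (auto elim!: dvdE)
        show "?P c N k l"
          apply (rule exI[of _ "k * c"], rule exI[of _ "- k * (a - 1)"],
            rule exI[of _ 0], rule exI[of _ y])
          using y pq[of k] unfolding d by (simp add: algebra_simps)
      qed (use 3 in simp)
    next
      case 4
      show ?thesis
      proof (rule exI[of _ 1], intro conjI allI impI)
        fix N k l
        show "?P 1 N k l"
          by (rule exI[of _ k], rule exI[of _ l], rule exI[of _ 0], rule exI[of _ 0])
             (simp add: 4 d)
      qed simp
    qed
  qed
  then obtain e where e: "e \<noteq> 0" "\<And>N k l. N dvd k * a + l * c - k \<Longrightarrow> N dvd k * b + l * d - l \<Longrightarrow> ?P e N k l"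
    by blast
  show ?thesis
  proof (rule that[OF e(1)], unfold fixed_points_lift_def, intro allI impI)
    fix N k l :: int
    assume "coprime e N" and dvd: "N dvd k * a + l * c - k" "N dvd k * b + l * d - l"
    then obtain x y where xy: "x * e + y * N = 1"
      by (metis bezout_int coprime_imp_gcd_eq_1)
    obtain f g k' l' where f: "e * k = f + N * k'" "e * l = g + N * l'"
      "f * a + g * c = f" "f * b + g * d = g"
      using e(2)[OF dvd] by blast
    have k: "k = x * f + N * (x * k' + y * k)" "l = x * g + N * (x * l' + y * l)"
    proof -
      have "m = x * (e * m) + N * (y * m)" for m
      proof -
        have "m = (x * e + y * N) * m" by (simp add: xy)
        thus ?thesis by (simp add: algebra_simps)
      qed
      from this[of k] this[of l] show "k = x * f + N * (x * k' + y * k)" "l = x * g + N * (x * l' + y * l)"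
        unfolding f(1,2) by (simp_all add: algebra_simps)
    qed
    have "x * f * a + x * g * c = x * (f * a + g * c)" "x * f * b + x * g * d = x * (f * b + g * d)"
      by (simp_all add: algebra_simps)
    hence "x * f * a + x * g * c = x * f" "x * f * b + x * g * d = x * g"
      unfolding f(3,4) .
    with k show "\<exists>f g k' l'. k = f + N * k' \<and> l = g + N * l' \<and> f * a + g * c = f \<and> f * b + g * d = g"
      by blast
  qed
qed

section \<open>Intertwiners\<close>

locale weyl_intertwiner = weyl_system +
  fixes L L' :: "complex mat" and a b c d :: int
  assumes L_carrier: "L \<in> carrier_mat n n" and L'_carrier: "L' \<in> carrier_mat n n"
    and L_L': "L * L' = 1\<^sub>m n" and L'_L: "L' * L = 1\<^sub>m n"
    and det_L: "cmod (det L) = 1"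
    and det_g: "a * d - b * c = 1"
    and intertwine: "\<And>k l. W (k * a + l * c) (k * b + l * d) = L * W k l * L'"
begin

lemma intertwine_left: "W (k * a + l * c) (k * b + l * d) * L = L * W k l"
proof -
  have "W (k * a + l * c) (k * b + l * d) * L = L * W k l * (L' * L)"
    unfolding intertwine using L_carrier L'_carrier
    by (intro assoc_mult_mat[of _ n n _ n _ n]) auto
  thus ?thesis using L_carrier by (simp add: L'_L)
qed

text \<open>
Both sides are scalar matrices, and conjugation by \<open>L\<close> fixes scalars.
\<close>

lemma weyl_multiple_invariant:
  "W (int n * (k * a + l * c)) (int n * (k * b + l * d)) = W (int n * k) (int n * l)"
proof -
  obtain t where t: "W (int n * k) (int n * l) = t \<cdot>\<^sub>m 1\<^sub>m n"
    using weyl_multiple by blast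
  have "W (int n * (k * a + l * c)) (int n * (k * b + l * d))
      = W (int n * k * a + int n * l * c) (int n * k * b + int n * l * d)"
    by (rule arg_cong2[where f = W]) (simp_all add: algebra_simps)
  also have "\<dots> = L * (t \<cdot>\<^sub>m 1\<^sub>m n) * L'" unfolding intertwine t ..
  also have "\<dots> = t \<cdot>\<^sub>m (L * L')"
    using L_carrier L'_carrier
    by (simp add: mult_smult_distrib[of _ n n _ n] mult_smult_assoc_mat[of _ n n _ n])
  finally show ?thesis unfolding L_L' t .
qed

text \<open>
The scalars \<open>W (n k) (n l)\<close> have modulus \<open>(|u|\<^sup>k|v|\<^sup>l)\<^sup>n\<close>, so their invariance passes to the
positive \<open>n\<close>-th roots.
\<close>

lemma modulus_invariant:
  "cmod u powi (k * a + l * c) * cmod v powi (k * b + l * d) = cmod u powi k * cmod v powi l"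
proof -
  have s1: "cmod s = 1" by (simp add: q_half_def norm_exp_eq_Re)
  have m: "cmod (W (int n * k) (int n * l) $$ (0, 0)) = (cmod u powi k * cmod v powi l) ^ n" for k l
    unfolding weyl_multiple using n_pos
    by (simp add: norm_mult norm_power norm_power_int s1 power_mult_distrib mult.commute[of "int n"] power_int_mult)
  have "(cmod u powi (k * a + l * c) * cmod v powi (k * b + l * d)) ^ n
      = (cmod u powi k * cmod v powi l) ^ n"
    unfolding m[symmetric] weyl_multiple_invariant ..
  thus ?thesis by (rule power_eq_imp_eq_base) (use n_pos in auto)
qed

text \<open>
Taking adjoints in \<open>L W(-x) = W(-gx) L\<close> gives \<open>W(x) L\<^sup>* = L\<^sup>* W(gx)\<close>, since the factors in
\<open>ctranspose_weyl\<close> for \<open>x\<close> and \<open>gx\<close> agree.  So \<open>L\<^sup>*L\<close> commutes with every \<open>W(x)\<close> and is a scalar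
\<open>h \<ge> 0\<close>, and \<open>h\<^sup>n = |det L|\<^sup>2 = 1\<close>.
\<close>

lemma unitary: "ctranspose L * L = 1\<^sub>m n"
proof -
  let ?H = "ctranspose L * L"
  have C: "ctranspose L \<in> carrier_mat n n" and H: "?H \<in> carrier_mat n n"
    using L_carrier by auto
  have half: "W k l * ctranspose L = ctranspose L * W (k * a + l * c) (k * b + l * d)" for k l
  proof -
    define r :: complex where "r = of_real ((cmod u powi (- k) * cmod v powi (- l))\<^sup>2)"
    have r: "r \<noteq> 0" using u_nz v_nz by (simp add: r_def)
    have r': "of_real ((cmod u powi (- (k * a + l * c)) * cmod v powi (- (k * b + l * d)))\<^sup>2) = r"
      using modulus_invariant[of "- k" "- l"] by (simp add: r_def)
    have "ctranspose (L * W (- k) (- l)) = ctranspose (W (- (k * a + l * c)) (- (k * b + l * d)) * L)"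
      using intertwine_left[of "- k" "- l"] by simp
    hence "r \<cdot>\<^sub>m (W k l * ctranspose L) =
        r \<cdot>\<^sub>m (ctranspose L * W (k * a + l * c) (k * b + l * d))"
      unfolding ctranspose_mult[OF L_carrier weyl_carrier(1)]
        ctranspose_mult[OF weyl_carrier(1) L_carrier] ctranspose_weyl r' r_def[symmetric]
      using C by (simp add: mult_smult_distrib[of _ n n _ n] mult_smult_assoc_mat[of _ n n _ n]
          add.commute[of "l * c"] add.commute[of "l * d"])
    hence "inverse r \<cdot>\<^sub>m (r \<cdot>\<^sub>m (W k l * ctranspose L)) =
        inverse r \<cdot>\<^sub>m (r \<cdot>\<^sub>m (ctranspose L * W (k * a + l * c) (k * b + l * d)))"
      by (rule arg_cong)
    moreover have "inverse r \<cdot>\<^sub>m (r \<cdot>\<^sub>m M) = M" for M :: "complex mat"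
      using r by (intro eq_matI) auto
    ultimately show ?thesis by simp
  qed
  have "W k l * ?H = ?H * W k l" for k l
  proof -
    have "W k l * ?H = W k l * ctranspose L * L"
      using C L_carrier by (simp add: assoc_mult_mat[of _ n n _ n _ n])
    also have "\<dots> = ctranspose L * (W (k * a + l * c) (k * b + l * d) * L)"
      unfolding half using C L_carrier by (simp add: assoc_mult_mat[of _ n n _ n _ n])
    also have "\<dots> = ?H * W k l"
      unfolding intertwine_left using C L_carrier by (simp add: assoc_mult_mat[of _ n n _ n _ n])
    finally show ?thesis .
  qed
  from weyl_schur[OF H this] have scalar: "?H = (mat_trace ?H / of_nat n) \<cdot>\<^sub>m 1\<^sub>m n" .
  \<comment> \<open>The scalar is recognised as nonnegative because its trace is the sum of all \<open>|L\<^sub>j\<^sub>i|\<^sup>2\<close>.\<close>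
  define h where "h = (\<Sum>i<n. \<Sum>j<n. (cmod (L $$ (j, i)))\<^sup>2) / real n"
  have "mat_trace ?H = (\<Sum>i<n. \<Sum>j<n. of_real ((cmod (L $$ (j, i)))\<^sup>2))"
    using L_carrier
    by (auto simp: mat_trace_def scalar_prod_def atLeast0LessThan cnj_mult_self
        simp del: of_real_power intro!: sum.cong)
  hence Hh: "?H = of_real h \<cdot>\<^sub>m 1\<^sub>m n"
    using scalar by (simp add: h_def)
  have "det ?H = cnj (det L) * det L"
    using C L_carrier by (simp add: det_mult[of _ n] det_ctranspose)
  also have "\<dots> = 1" using det_L by (metis complex_norm_square mult.commute of_real_1 one_power2)
  finally have "of_real (h ^ n) = (1 :: complex)" unfolding Hh by simp
  hence "h ^ n = 1 ^ n" by (simp only: of_real_eq_1_iff power_one)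
  moreover have "h \<ge> 0" by (auto simp: h_def intro!: sum_nonneg divide_nonneg_nonneg)
  ultimately have "h = 1" by (intro power_eq_imp_eq_base[of h n 1]) (use n_pos in auto)
  thus ?thesis using Hh by (auto intro!: eq_matI)
qed

lemma inverse_eq_ctranspose: "L' = ctranspose L"
proof -
  have "ctranspose L = ctranspose L * (L * L')" using L_carrier by (simp add: L_L')
  also have "\<dots> = ctranspose L * L * L'"
    using L_carrier L'_carrier by (subst assoc_mult_mat[of _ n n _ n _ n]) auto
  finally show ?thesis using L'_carrier by (simp add: unitary)
qed

lemma cmod_trace_le: "cmod (mat_trace L) \<le> real n"
proof -
  have "cmod (L $$ (j, j)) \<le> 1" if j: "j < n" for j
  proof -
    have "(ctranspose L * L) $$ (j, j) = (\<Sum>i<n. of_real ((cmod (L $$ (i, j)))\<^sup>2))"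
      using L_carrier j
      by (auto simp: scalar_prod_def atLeast0LessThan cnj_mult_self
        simp del: of_real_power intro!: sum.cong)
    hence "complex_of_real (\<Sum>i<n. (cmod (L $$ (i, j)))\<^sup>2) = 1"
      using j by (simp add: unitary)
    hence "(\<Sum>i<n. (cmod (L $$ (i, j)))\<^sup>2) = 1" by (simp only: of_real_eq_1_iff)
    moreover have "(cmod (L $$ (j, j)))\<^sup>2 \<le> (\<Sum>i<n. (cmod (L $$ (i, j)))\<^sup>2)"
      using j by (intro member_le_sum) auto
    ultimately show ?thesis by (simp add: power_le_one_iff abs_square_le_1)
  qed
  hence "(\<Sum>j<n. cmod (L $$ (j, j))) \<le> (\<Sum>j<n. 1)" by (intro sum_mono) auto
  moreover have "cmod (mat_trace L) \<le> (\<Sum>j<n. cmod (L $$ (j, j)))"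
    using L_carrier by (simp add: mat_trace_def norm_sum)
  ultimately show ?thesis by simp
qed

definition fixed_residues :: "(nat \<times> nat) set" where
  "fixed_residues = {(k, l) \<in> {..<n} \<times> {..<n}.
     int n dvd int k * a + int l * c - int k \<and> int n dvd int k * b + int l * d - int l}"

text \<open>
By \<open>weyl_mult\<close>, \<open>W(x + ny)\<close> is a multiple of \<open>W(x) W(ny)\<close> by a power of \<open>q\<^bsup>1/2\<^esup>\<close> whose exponent
is the symplectic form.  When \<open>x\<close> is a fixed vector, nothing in this product changes under \<open>g\<close>:
the form is preserved because \<open>g\<close> has determinant one, and \<open>W(ny)\<close> by \<open>weyl_multiple_invariant\<close>.
\<close>

lemma weyl_fixed:
  assumes fix1: "f * a + g * c = f" and fix2: "f * b + g * d = g"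
    and kl: "k = f + int n * k'" "l = g + int n * l'"
  shows "W (k * a + l * c) (k * b + l * d) = W k l"
proof -
  have split: "W (f + int n * x) (g + int n * y) =
      s powi (- (f * (int n * y) - g * (int n * x))) \<cdot>\<^sub>m (W f g * W (int n * x) (int n * y))" for x y
  proof -
    have "s powi (- (f * (int n * y) - g * (int n * x))) * s powi (f * (int n * y) - g * (int n * x)) = 1"
      by (simp flip: power_int_add)
    thus ?thesis unfolding weyl_mult by (intro eq_matI) (simp_all flip: mult.assoc)
  qed
  define x y where "x = k' * a + l' * c" and "y = k' * b + l' * d"
  have "k * a + l * c = (f * a + g * c) + int n * x" "k * b + l * d = (f * b + g * d) + int n * y"
    unfolding kl x_def y_def by (simp_all add: algebra_simps)
  hence "k * a + l * c = f + int n * x" "k * b + l * d = g + int n * y"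
    unfolding fix1 fix2 .
  moreover have "f * (int n * y) - g * (int n * x) = f * (int n * l') - g * (int n * k')"
  proof -
    have "(f * a + g * c) * (int n * y) - (f * b + g * d) * (int n * x)
        = (a * d - b * c) * (f * (int n * l') - g * (int n * k'))"
      unfolding x_def y_def by (simp add: algebra_simps)
    thus ?thesis unfolding fix1 fix2 det_g by simp
  qed
  moreover have "W (int n * x) (int n * y) = W (int n * k') (int n * l')"
    unfolding x_def y_def by (rule weyl_multiple_invariant)
  moreover have "W k l = s powi (- (f * (int n * l') - g * (int n * k'))) \<cdot>\<^sub>m
      (W f g * W (int n * k') (int n * l'))"
    unfolding kl by (rule split)
  ultimately show ?thesis by (simp only: split)
qed

text \<open>
Both sides come from \<open>\<Sum>\<^sub>x Trace (W(x) L W(x)\<^bsup>-1\<^esup> L\<^bsup>-1\<^esup>)\<close> over \<open>x \<in> (\<int>/n)\<^sup>2\<close>.  The twirl evaluates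
it to \<open>n Trace L Trace L\<^bsup>-1\<^esup>\<close>.  On the other hand \<open>L W(x)\<^bsup>-1\<^esup> L\<^bsup>-1\<^esup> = W(-gx)\<close>, so each summand is
\<open>Trace (W(x) W(-gx))\<close>, which is \<open>n\<close> at fixed points and \<open>0\<close> elsewhere.
\<close>

lemma trace_product:
  assumes fixed: "\<And>k l. int n dvd k * a + l * c - k \<Longrightarrow> int n dvd k * b + l * d - l \<Longrightarrow>
    W (k * a + l * c) (k * b + l * d) = W k l"
  shows "mat_trace L * mat_trace L' = of_nat (card fixed_residues)"
proof -
  have conj_trace: "mat_trace (W k l * L * W (- k) (- l) * L') =
    (if int n dvd k * a + l * c - k \<and> int n dvd k * b + l * d - l then of_nat n else 0)" for k l
  proof -
    let ?k = "k * a + l * c" and ?l = "k * b + l * d"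
    have "W k l * L * W (- k) (- l) * L' = W k l * (L * W (- k) (- l) * L')"
      using L_carrier L'_carrier by (simp add: assoc_mult_mat[of _ n n _ n _ n])
    also have "\<dots> = W k l * W (- ?k) (- ?l)"
      unfolding intertwine[symmetric] by simp
    finally have e: "W k l * L * W (- k) (- l) * L' = W k l * W (- ?k) (- ?l)" .
    show ?thesis
    proof (cases "int n dvd ?k - k \<and> int n dvd ?l - l")
      case True
      hence "W ?k ?l = W k l" using fixed by blast
      hence "W k l * W (- ?k) (- ?l) = 1\<^sub>m n" using weyl_mult_minus by metis
      thus ?thesis using True by (simp add: e mat_trace_def)
    next
      case False
      hence "\<not> (int n dvd k + - ?k \<and> int n dvd l + - ?l)"
        by (metis dvd_minus_iff minus_diff_eq uminus_add_conv_diff add.commute)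
      hence "mat_trace (W (k + - ?k) (l + - ?l)) = 0" by (rule mat_trace_weyl)
      thus ?thesis using False unfolding e weyl_mult
        by (subst mat_trace_smult[of _ n]) auto
    qed
  qed
  have tr: "mat_trace (M * L') = (\<Sum>j<n. \<Sum>i<n. M $$ (j, i) * L' $$ (i, j))"
    if "M \<in> carrier_mat n n" for M
    using that L'_carrier
    by (auto simp: mat_trace_def scalar_prod_def atLeast0LessThan intro!: sum.cong)
  have "(\<Sum>k<n. \<Sum>l<n. mat_trace (W (int k) (int l) * L * W (- int k) (- int l) * L'))
    = (\<Sum>k<n. \<Sum>l<n. \<Sum>j<n. \<Sum>i<n.
        (W (int k) (int l) * L * W (- int k) (- int l)) $$ (j, i) * L' $$ (i, j))"
    using L_carrier by (intro sum.cong refl tr) (auto intro!: mult_carrier_mat[of _ n n])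
  also have "\<dots> = (\<Sum>j<n. \<Sum>i<n. \<Sum>k<n. \<Sum>l<n.
        (W (int k) (int l) * L * W (- int k) (- int l)) $$ (j, i) * L' $$ (i, j))"
    by (rule sum_swap_pairs)
  also have "\<dots> = (\<Sum>j<n. \<Sum>i<n. (if i = j then of_nat n * mat_trace L else 0) * L' $$ (i, j))"
    by (rule sum.cong[OF refl], rule sum.cong[OF refl])
       (simp only: weyl_twirl[OF L_carrier] lessThan_iff flip: sum_distrib_right)
  also have "\<dots> = (\<Sum>j<n. of_nat n * mat_trace L * L' $$ (j, j))"
    by (intro sum.cong refl) (simp add: if_distrib[of "\<lambda>x. x * _"] cong: if_cong)
  also have "\<dots> = of_nat n * (mat_trace L * mat_trace L')"
    using L'_carrier by (simp add: mat_trace_def[of L'] sum_distrib_left mult.assoc)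
  finally have "of_nat n * (mat_trace L * mat_trace L') =
     (\<Sum>k<n. \<Sum>l<n. if int n dvd int k * a + int l * c - int k \<and>
        int n dvd int k * b + int l * d - int l then of_nat n else 0)"
    unfolding conj_trace ..
  also have "\<dots> = (\<Sum>x\<in>fixed_residues. of_nat n)"
    unfolding sum.cartesian_product fixed_residues_def
    by (rule sum.mono_neutral_cong_right) (auto split: if_splits)
  finally show ?thesis using n_pos by simp
qed

text \<open>
Here \<open>L\<^bsup>-1\<^esup> = L\<^sup>*\<close> turns the product of traces into \<open>|Trace L|\<^sup>2\<close>, and the origin is always a fixed
point.
\<close>

lemma one_le_cmod_trace:
  assumes "fixed_points_lift a b c d (int n)"
  shows "1 \<le> cmod (mat_trace L)"
proof -
  have "mat_trace L * mat_trace L' = of_nat (card fixed_residues)"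
    using assms weyl_fixed unfolding fixed_points_lift_def by (intro trace_product) blast
  moreover have "mat_trace L' = cnj (mat_trace L)"
    unfolding inverse_eq_ctranspose using L_carrier by (rule mat_trace_ctranspose)
  ultimately have "complex_of_real ((cmod (mat_trace L))\<^sup>2) = of_real (real (card fixed_residues))"
    by (simp only: complex_norm_square of_real_of_nat_eq)
  hence sq: "(cmod (mat_trace L))\<^sup>2 = real (card fixed_residues)" by (simp only: of_real_eq_iff)
  have "fixed_residues \<subseteq> {..<n} \<times> {..<n}" "(0, 0) \<in> fixed_residues"
    using n_pos by (auto simp: fixed_residues_def)
  hence "finite fixed_residues" "(0, 0) \<in> fixed_residues"
    by (auto intro: finite_subset)
  hence "card fixed_residues \<ge> 1" by (metis One_nat_def Suc_leI card_gt_0_iff empty_iff)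
  hence "(cmod (mat_trace L))\<^sup>2 \<ge> 1" unfolding sq by simp
  thus ?thesis by (intro power2_le_imp_le[of 1]) auto
qed

end

section \<open>Growth of the traces\<close>

lemma intertwines_imp_weyl_intertwiner:
  assumes "n > 0" "u \<noteq> 0" "v \<noteq> 0"
    and L: "intertwines n F u v L" "cmod (det L) = 1"
    and F: "\<And>k l. F (qt_theta (q_half n) (k, l)) = qt_theta (q_half n) (k * a + l * c, k * b + l * d)"
    and det: "a * d - b * c = 1"
  obtains L' where "weyl_intertwiner n u v L L' a b c d"
proof -
  obtain L' where L': "L \<in> carrier_mat n n" "L' \<in> carrier_mat n n" "inverts_mat L L'" "inverts_mat L' L"
    "\<And>Z. rho n u v (F Z) = L * rho n u v Z * L'"
    using L(1) by (auto simp: intertwines_def)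
  have "weyl_intertwiner n u v L L' a b c d"
  proof
    show "weyl n u v (k * a + l * c) (k * b + l * d) = L * weyl n u v k l * L'" for k l
      unfolding weyl_def F[symmetric] by (rule L'(5))
  qed (use assms L' in \<open>auto simp: inverts_mat_def\<close>)
  thus thesis by (rule that)
qed

lemma intertwiner_trace_bounds:
  assumes uv: "u ^ n = - z" "v ^ n = - w" and "z \<noteq> 0" "w \<noteq> 0" "n > 0"
    and "intertwines n F u v L" "cmod (det L) = 1"
    and "\<And>k l. F (qt_theta (q_half n) (k, l)) = qt_theta (q_half n) (k * a + l * c, k * b + l * d)"
    and "a * d - b * c = 1"
  shows "cmod (mat_trace L) \<le> real n"
    and "fixed_points_lift a b c d (int n) \<Longrightarrow> 1 \<le> cmod (mat_trace L)"
proof -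
  have "u \<noteq> 0" "v \<noteq> 0" using uv \<open>z \<noteq> 0\<close> \<open>w \<noteq> 0\<close> \<open>n > 0\<close> by (auto simp: zero_power)
  with \<open>n > 0\<close> obtain L' where "weyl_intertwiner n u v L L' a b c d"
    using intertwines_imp_weyl_intertwiner assms(6-9) by blast
  then interpret weyl_intertwiner n u v L L' a b c d .
  show "cmod (mat_trace L) \<le> real n" by (rule cmod_trace_le)
  show "1 \<le> cmod (mat_trace L)" if "fixed_points_lift a b c d (int n)"
    using that by (rule one_le_cmod_trace)
qed

text \<open>
The upper bound compares with \<open>ln n / n\<close>.  For the lower bound, the odd numbers \<open>2|e|m + 1\<close> are
coprime to \<open>e\<close>, and passing to this subsequence can only decrease the limit superior.
\<close>

lemma limsup_log_ext_odd_eq_0: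
  fixes t :: "nat \<Rightarrow> real" and e :: int
  assumes nonneg: "\<And>n. odd n \<Longrightarrow> 0 \<le> t n" and upper: "\<And>n. odd n \<Longrightarrow> t n \<le> real n"
    and "e \<noteq> 0" and lower: "\<And>n. odd n \<Longrightarrow> coprime e (int n) \<Longrightarrow> 1 \<le> t n"
  shows "limsup (\<lambda>m. let n = 2 * m + 1 in log_ext (t n) / ereal (real n)) = 0"
proof (rule antisym)
  let ?f = "\<lambda>m. let n = 2 * m + 1 in log_ext (t n) / ereal (real n)"
  have le: "?f m \<le> ereal (ln (real (2 * m + 1)) / real (2 * m + 1))" for m
  proof (cases "t (2 * m + 1) = 0")
    case True
    thus ?thesis by (simp add: log_ext_def)
  next
    case False
    moreover have "0 \<le> t (2 * m + 1)" "t (2 * m + 1) \<le> real (2 * m + 1)"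
      by (rule nonneg upper, simp)+
    ultimately have "ln (t (2 * m + 1)) \<le> ln (real (2 * m + 1))"
      by (subst ln_le_cancel_iff) auto
    hence "ln (t (2 * m + 1)) / real (2 * m + 1) \<le> ln (real (2 * m + 1)) / real (2 * m + 1)"
      by (intro divide_right_mono) auto
    thus ?thesis using False by (simp only: Let_def log_ext_def if_False) simp
  qed
  have "filterlim (\<lambda>m. 2 * m + 1 :: nat) at_top sequentially"
    by (rule filterlim_subseq) (auto simp: strict_mono_def)
  hence "filterlim (\<lambda>m. real (2 * m + 1)) at_top sequentially"
    by (rule filterlim_compose[OF filterlim_real_sequentially])
  from filterlim_compose[OF ln_x_over_x_tendsto_0 this]
  have "(\<lambda>m. ereal (ln (real (2 * m + 1)) / real (2 * m + 1))) \<longlonglongrightarrow> ereal 0"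
    by (rule tendsto_ereal)
  hence "limsup (\<lambda>m. ereal (ln (real (2 * m + 1)) / real (2 * m + 1))) = ereal 0"
    by (intro lim_imp_Limsup) auto
  moreover have "limsup ?f \<le> limsup (\<lambda>m. ereal (ln (real (2 * m + 1)) / real (2 * m + 1)))"
    by (intro Limsup_mono always_eventually allI le)
  ultimately show "limsup ?f \<le> 0" by (simp add: zero_ereal_def)
  define r where "r = (\<lambda>m. nat \<bar>e\<bar> * m)"
  have "strict_mono r" using \<open>e \<noteq> 0\<close> by (auto simp: r_def strict_mono_def)
  have "0 \<le> (?f \<circ> r) m" for m
  proof -
    have "coprime e (int (2 * r m + 1))"
    proof (rule coprimeI)
      fix x assume x: "x dvd e" "x dvd int (2 * r m + 1)"
      hence "x dvd \<bar>e\<bar> * (2 * int m)" by simp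
      hence "x dvd int (2 * r m)" by (simp add: r_def mult_ac)
      hence "x dvd int (2 * r m + 1) - int (2 * r m)" using x(2) dvd_diff by blast
      thus "is_unit x" by simp
    qed
    hence t: "1 \<le> t (2 * r m + 1)" by (intro lower) simp_all
    hence "0 \<le> ln (t (2 * r m + 1)) / real (2 * r m + 1)" by simp
    thus ?thesis using t by (simp add: log_ext_def Let_def)
  qed
  hence "0 \<le> limsup (?f \<circ> r)" by (intro le_Limsup always_eventually allI) auto
  also have "\<dots> \<le> limsup ?f" by (rule limsup_subseq_mono) fact
  finally show "0 \<le> limsup ?f" .
qed

text \<open>
Since \<open>inverse 0 = 0\<close>, the determinant of \<open>diag2 0\<close> is \<open>0\<close>.
\<close>

lemma diag2_mem_SL2_imp_nonzero:
  assumes "diag2 z \<in> carrier SL2"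
  shows "z \<noteq> 0"
proof
  assume "z = 0"
  moreover have "diag2 z \<in> carrier_mat 2 2" "det (diag2 z) = 1"
    using assms by (auto simp: SL2_def)
  ultimately show False using mat_det_2[of "diag2 z"] by (simp add: diag2_def)
qed

theorem theorem1p1:
  fixes A :: "int mat" and a b c d :: int
    and \<gamma> :: "int \<times> int \<Rightarrow> complex mat" and z1 z2 :: complex
    and \<Lambda> :: "nat \<Rightarrow> complex mat"
  assumes A: "A \<in> carrier SL2"
    and entries: "a = A $$ (0,0)" "b = A $$ (0,1)" "c = A $$ (1,0)" "d = A $$ (1,1)"
    and \<gamma>: "\<gamma> \<in> hom pi1_torus SL2" "\<gamma> (1, 0) = diag2 z1" "\<gamma> (0, 1) = diag2 z2"
    and invariant: "A_invariant A \<gamma>"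
    and \<Lambda>:
      "(1 = z1 powi (a - 1) * z2 powi b \<and> 1 = z1 powi c * z2 powi (d - 1) \<and>
          (\<forall>n. odd n \<longrightarrow> plus_intertwiner A z1 z2 n (\<Lambda> n)))
       \<or> (1 = z1 powi (a + 1) * z2 powi b \<and> 1 = z1 powi c * z2 powi (d + 1) \<and>
          (\<forall>n. odd n \<longrightarrow> minus_intertwiner A z1 z2 n (\<Lambda> n)))"
    and normalized: "\<forall>n. odd n \<longrightarrow> cmod (det (\<Lambda> n)) = 1"
  shows "limsup (\<lambda>m. let n = 2 * m + 1 in log_ext (cmod (mat_trace (\<Lambda> n))) / ereal (real n)) = 0"
proof -
  have "\<gamma> (1, 0) \<in> carrier SL2" "\<gamma> (0, 1) \<in> carrier SL2"
    using \<gamma>(1) by (auto simp: hom_def pi1_torus_def DirProd_def)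
  hence z: "z1 \<noteq> 0" "z2 \<noteq> 0" unfolding \<gamma>(2,3) by (blast dest: diag2_mem_SL2_imp_nonzero)+
  have det: "a * d - b * c = 1" using SL2_int_det[OF A] by (simp only: entries)
  have act: "pi1_act A (k, l) = (k * a + l * c, k * b + l * d)" for k l
    by (simp add: pi1_act_def entries)
  (* The (+) and (-) cases are the same statement, for the matrices A and -A and for the
     n-th powers of u, v prescribed by z1, z2 and by their inverses. *)
  have core: "limsup (\<lambda>m. let n = 2 * m + 1 in log_ext (cmod (mat_trace (\<Lambda> n))) / ereal (real n)) = 0"
    if det': "a' * d' - b' * c' = 1" and w: "w1 \<noteq> 0" "w2 \<noteq> 0"
      and F: "\<And>n k l. F n (qt_theta (q_half n) (k, l))
        = qt_theta (q_half n) (k * a' + l * c', k * b' + l * d')"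
      and I: "\<And>n. odd n \<Longrightarrow> \<exists>u v. u ^ n = - w1 \<and> v ^ n = - w2 \<and> intertwines n (F n) u v (\<Lambda> n)"
    for a' b' c' d' :: int and w1 w2 :: complex and F
  proof -
    obtain e where "e \<noteq> 0" and e: "\<And>N. coprime e N \<Longrightarrow> fixed_points_lift a' b' c' d' N"
      using fixed_points_lift_coprime[OF det'] by blast
    show ?thesis
    proof (rule limsup_log_ext_odd_eq_0[OF _ _ \<open>e \<noteq> 0\<close>])
      fix n :: nat assume n: "odd n"
      then obtain u v where uv: "u ^ n = - w1" "v ^ n = - w2" "intertwines n (F n) u v (\<Lambda> n)"
        using I by blast
      have det_n: "cmod (det (\<Lambda> n)) = 1" using normalized n by blast
      note bounds = intertwiner_trace_bounds[OF uv(1,2) w odd_pos[OF n] uv(3) det_n F det']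
      show "cmod (mat_trace (\<Lambda> n)) \<le> real n" by (rule bounds(1))
      assume "coprime e (int n)"
      show "1 \<le> cmod (mat_trace (\<Lambda> n))"
        by (rule bounds(2)) (rule e[OF \<open>coprime e (int n)\<close>])
    qed simp
  qed
  from \<Lambda> show ?thesis
  proof (elim disjE conjE)
    assume "\<forall>n. odd n \<longrightarrow> plus_intertwiner A z1 z2 n (\<Lambda> n)"
    thus ?thesis
      by (intro core[OF det z, where F = "\<lambda>n. F_plus (q_half n) A"])
         (auto simp: F_plus_theta act plus_intertwiner_def)
  next
    assume "\<forall>n. odd n \<longrightarrow> minus_intertwiner A z1 z2 n (\<Lambda> n)"
    thus ?thesis using det z
      by (intro core[of "- a" "- d" "- b" "- c" "inverse z1" "inverse z2" "\<lambda>n. F_minus (q_half n) A"])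
         (auto simp: F_minus_theta act minus_intertwiner_def)
  qed
qed

end
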